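(* Let $1_{\mathbf{Set}}$ be the identity functor on $\mathbf{Set}$. Then $\mathbf{Pfn}_{1_{\mathbf{Set}}}$ is prodominical but not dominical.
   Context: For an endofunctor $F$ on $\mathbf{Set}$ (here $F=1_{\mathbf{Set}}$), an $F$-coalgebra is a set $A$ with a map $\alpha:A\to FA$; a morphism $(A,\alpha)\to(B,\beta)$ is a map $\varphi$ with $\beta\varphi=F(\varphi)\alpha$; these form $\mathbf{Set}_F$. For $F=1_{\mathbf{Set}}$, $\mathbf{Set}_F$ is complete and its monomorphisms are exactly the injective morphisms. $\mathbf{Pfn}_F$ is the category with the $F$-coalgebras as objects, in which a morphism $X\to Y$ is an equivalence class $\{m,\varphi\}$ of pairs with $m:U\to X$ a monomorphism and $\varphi:U\to Y$ a morphism of $\mathbf{Set}_F$, where $(m,\varphi)\sim(m',\varphi')$ if $m=m'\theta$ and $\varphi=\varphi'\theta$ for an isomorphism $\theta$. Composition is by pullback: $\{m',\varphi'\}\circ\{m,\varphi\}=\{mq,\varphi'r\}$, where $q,r$ are the projections of the pullback of $\varphi$ and $m'$ (with $q$ the pullback of $m'$). $\mathbf{Set}_F$ is embedded by $\varphi\mapsto\{1,\varphi\}$. The near product is $X\boxtimes Y=X\times Y$ (product in $\mathbf{Set}_F$), $\{m,\varphi\}\boxtimes\{m',\varphi'\}=\{m\times m',\varphi\times\varphi'\}$, with the diagonals $\Delta$ and projections $p_0,p_1$ of $\mathbf{Set}_F$. An infranatural transformation $\phi:G\to H$ of functors is a family of components $\phi_X:GX\to HX$; $\mathrm{nat}\,\phi$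 is the largest subcategory, containing all objects, on which it is natural. A $P$-category is a category $\mathbf{C}$ with a functor $\boxtimes:\mathbf{C}^2\to\mathbf{C}$, a natural transformation $\Delta_X:X\to X\boxtimes X$, and infranatural transformations $p_i:\boxtimes\to\pi_i$ to the $i$-th projection functor ($i=0,1$) such that, with $\langle f,g\rangle=(f\boxtimes g)\Delta$: (i) $p_{i\,X,X}\Delta_X=1_X$ and $(p_{0\,X,X}\boxtimes p_{1\,X,X})\Delta_{X\boxtimes X}=1_{X\boxtimes X}$; (ii) if $\mathbf{P}$ is the smallest subcategory closed under $\boxtimes$ containing all components of $p_0,p_1$, then $\mathbf{C}\times\mathbf{P}\subseteq\mathrm{nat}\,p_0$ and $\mathbf{P}\times\mathbf{C}\subseteq\mathrm{nat}\,p_1$; (iii) $\langle p_0p_0,\langle p_1p_0,p_1\rangle\rangle:(X\boxtimes Y)\boxtimes Z\to X\boxtimes(Y\boxtimes Z)$ is a natural isomorphism; (iv) $\langle p_1,p_0\rangle:X\boxtimes Y\to Y\boxtimes X$ is a natural isomorphism; and these make $\boxtimes$ coherently associative and commutative (pentagon, hexagon, symmetry). The domain of $\phi:X\to Y$ is $\mathrm{dom}\,\phi=p_{0\,X,Y}\langle1_X,\phi\rangle:X\to X$; $\phi$ is total if $\mathrm{dom}\,\phi=1_X$. A system of zero morphisms is a family $0_{X,Y}:X\to Y$ with $g\,0_{X,Y}f=0_{W,Z}$ for all $f:W\to X$, $g:Y\to Z$ (unique if it exists; in $\mathbf{Pfn}_F$, $0_{A,B}=\{\emptyset\to A,\emptyset\to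 B\}$). A $P$-category is prodominical if it has a system of zero morphisms and $\phi\boxtimes0_{C,D}=0_{A\boxtimes C,B\boxtimes D}$ for every $\phi:A\to B$. A morphism $f:X\to Y$ is weakly total if for all $\phi:W\to X$, $f\phi=0_{W,Y}$ implies $\phi=0_{W,X}$. A prodominical category is dominical if every weakly total morphism is total and $\phi\boxtimes\psi=0$ implies $\phi=0$ or $\psi=0$. *)

theory Defs
  imports Main "HOL-Library.FuncSet" "HOL-Library.Equipollence"
begin

section \<open>Categories\<close>

record ('o, 'a) cat =
  Ob :: "'o set"
  Ar :: "'a set"
  Dom :: "'a \<Rightarrow> 'o"
  Cod :: "'a \<Rightarrow> 'o"
  Idn :: "'o \<Rightarrow> 'a"
  Comp :: "'a \<Rightarrow> 'a \<Rightarrow> 'a" (infixr "\<cdot>\<index>" 75)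

definition hom :: "('o, 'a, 'z) cat_scheme \<Rightarrow> 'o \<Rightarrow> 'o \<Rightarrow> 'a set" where
  "hom C X Y = {f \<in> Ar C. Dom C f = X \<and> Cod C f = Y}"

locale category =
  fixes C :: "('o, 'a, 'z) cat_scheme" (structure)
  assumes dom_ob: "f \<in> Ar C \<Longrightarrow> Dom C f \<in> Ob C"
    and cod_ob: "f \<in> Ar C \<Longrightarrow> Cod C f \<in> Ob C"
    and idn_hom: "X \<in> Ob C \<Longrightarrow> Idn C X \<in> hom C X X"
    and comp_hom: "\<lbrakk>f \<in> hom C X Y; g \<in> hom C Y Z\<rbrakk> \<Longrightarrow> g \<cdot> f \<in> hom C X Z"
    and comp_idn: "f \<in> hom C X Y \<Longrightarrow> f \<cdot> Idn C X = f"
    and idn_comp: "f \<in> hom C X Y \<Longrightarrow> Idn C Y \<cdot> f = f"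
    and comp_assoc: "\<lbrakk>f \<in> hom C W X; g \<in> hom C X Y; h \<in> hom C Y Z\<rbrakk>
                      \<Longrightarrow> (h \<cdot> g) \<cdot> f = h \<cdot> (g \<cdot> f)"

definition mono_ar :: "('o, 'a, 'z) cat_scheme \<Rightarrow> 'a \<Rightarrow> bool" where
  "mono_ar C m \<longleftrightarrow> m \<in> Ar C \<and>
     (\<forall>W \<in> Ob C. \<forall>f \<in> hom C W (Dom C m). \<forall>g \<in> hom C W (Dom C m).
        m \<cdot>\<^bsub>C\<^esub> f = m \<cdot>\<^bsub>C\<^esub> g \<longrightarrow> f = g)"

definition iso_ar :: "('o, 'a, 'z) cat_scheme \<Rightarrow> 'a \<Rightarrow> bool" where
  "iso_ar C f \<longleftrightarrow> f \<in> Ar C \<and>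
     (\<exists>g \<in> hom C (Cod C f) (Dom C f).
        g \<cdot>\<^bsub>C\<^esub> f = Idn C (Dom C f) \<and> f \<cdot>\<^bsub>C\<^esub> g = Idn C (Cod C f))"

definition is_product ::
    "('o, 'a, 'z) cat_scheme \<Rightarrow> 'o \<Rightarrow> 'o \<Rightarrow> 'o \<times> 'a \<times> 'a \<Rightarrow> bool" where
  "is_product C X Y = (\<lambda>(P, p, q).
     P \<in> Ob C \<and> p \<in> hom C P X \<and> q \<in> hom C P Y \<and>
     (\<forall>W \<in> Ob C. \<forall>f \<in> hom C W X. \<forall>g \<in> hom C W Y.
        \<exists>!h. h \<in> hom C W P \<and> p \<cdot>\<^bsub>C\<^esub> h = f \<and> q \<cdot>\<^bsub>C\<^esub> h = g))"

text \<open>\<open>q\<close> and \<open>r\<close> are the projections of a pullback of \<open>f : U \<rightarrow> Y\<close> and \<open>g : V \<rightarrow> Y\<close>,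
  to \<open>U\<close> and \<open>V\<close> respectively.\<close>

definition is_pullback ::
    "('o, 'a, 'z) cat_scheme \<Rightarrow> 'a \<Rightarrow> 'a \<Rightarrow> 'a \<Rightarrow> 'a \<Rightarrow> bool" where
  "is_pullback C f g q r \<longleftrightarrow>
     f \<in> Ar C \<and> g \<in> Ar C \<and> q \<in> Ar C \<and> r \<in> Ar C \<and>
     Cod C f = Cod C g \<and> Dom C q = Dom C r \<and> Cod C q = Dom C f \<and> Cod C r = Dom C g \<and>
     f \<cdot>\<^bsub>C\<^esub> q = g \<cdot>\<^bsub>C\<^esub> r \<and>
     (\<forall>W \<in> Ob C. \<forall>s \<in> hom C W (Dom C f). \<forall>t \<in> hom C W (Dom C g).
        f \<cdot>\<^bsub>C\<^esub> s = g \<cdot>\<^bsub>C\<^esub> t \<longrightarrow>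
        (\<exists>!h. h \<in> hom C W (Dom C q) \<and> q \<cdot>\<^bsub>C\<^esub> h = s \<and> r \<cdot>\<^bsub>C\<^esub> h = t))"

text \<open>A subcategory is given by its set of arrows; its objects are those whose identity it
  contains.\<close>

definition subcategory :: "('o, 'a, 'z) cat_scheme \<Rightarrow> 'a set \<Rightarrow> bool" where
  "subcategory C S \<longleftrightarrow> S \<subseteq> Ar C \<and>
     (\<forall>f \<in> S. Idn C (Dom C f) \<in> S \<and> Idn C (Cod C f) \<in> S) \<and>
     (\<forall>f \<in> S. \<forall>g \<in> S. Dom C g = Cod C f \<longrightarrow> g \<cdot>\<^bsub>C\<^esub> f \<in> S)"

definition wide_subcategory :: "('o, 'a, 'z) cat_scheme \<Rightarrow> 'a set \<Rightarrow> bool" where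
  "wide_subcategory C S \<longleftrightarrow> subcategory C S \<and> (\<forall>X \<in> Ob C. Idn C X \<in> S)"

definition prod_cat ::
    "('o, 'a, 'z) cat_scheme \<Rightarrow> ('p, 'b, 'y) cat_scheme \<Rightarrow> ('o \<times> 'p, 'a \<times> 'b) cat"
    (infixr "\<times>\<^sub>C" 80) where
  "A \<times>\<^sub>C B =
     \<lparr>Ob = Ob A \<times> Ob B, Ar = Ar A \<times> Ar B,
      Dom = map_prod (Dom A) (Dom B), Cod = map_prod (Cod A) (Cod B),
      Idn = map_prod (Idn A) (Idn B),
      Comp = (\<lambda>(g, g') (f, f'). (g \<cdot>\<^bsub>A\<^esub> f, g' \<cdot>\<^bsub>B\<^esub> f'))\<rparr>"


section \<open>Functors and infranatural transformations\<close>

record ('o, 'a, 'p, 'b) func =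
  FOb :: "'o \<Rightarrow> 'p"
  FAr :: "'a \<Rightarrow> 'b"

definition is_functor ::
    "('o, 'a, 'z) cat_scheme \<Rightarrow> ('p, 'b, 'y) cat_scheme \<Rightarrow> ('o, 'a, 'p, 'b) func \<Rightarrow> bool" where
  "is_functor A B F \<longleftrightarrow>
     (\<forall>X \<in> Ob A. FOb F X \<in> Ob B \<and> FAr F (Idn A X) = Idn B (FOb F X)) \<and>
     (\<forall>f \<in> Ar A. FAr F f \<in> hom B (FOb F (Dom A f)) (FOb F (Cod A f))) \<and>
     (\<forall>f \<in> Ar A. \<forall>g \<in> Ar A. Dom A g = Cod A f \<longrightarrow>
        FAr F (g \<cdot>\<^bsub>A\<^esub> f) = FAr F g \<cdot>\<^bsub>B\<^esub> FAr F f)"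

definition id_func :: "('o, 'a, 'o, 'a) func" where
  "id_func = \<lparr>FOb = (\<lambda>X. X), FAr = (\<lambda>f. f)\<rparr>"

definition infranatural ::
    "('o, 'a, 'z) cat_scheme \<Rightarrow> ('p, 'b, 'y) cat_scheme \<Rightarrow> ('o, 'a, 'p, 'b) func \<Rightarrow>
     ('o, 'a, 'p, 'b) func \<Rightarrow> ('o \<Rightarrow> 'b) \<Rightarrow> bool" where
  "infranatural A B G H \<phi> \<longleftrightarrow> (\<forall>X \<in> Ob A. \<phi> X \<in> hom B (FOb G X) (FOb H X))"

definition natural_on ::
    "('o, 'a, 'z) cat_scheme \<Rightarrow> ('p, 'b, 'y) cat_scheme \<Rightarrow> ('o, 'a, 'p, 'b) func \<Rightarrow>
     ('o, 'a, 'p, 'b) func \<Rightarrow> ('o \<Rightarrow> 'b) \<Rightarrow> 'a set \<Rightarrow> bool" where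
  "natural_on A B G H \<phi> S \<longleftrightarrow>
     (\<forall>f \<in> S. \<phi> (Cod A f) \<cdot>\<^bsub>B\<^esub> FAr G f = FAr H f \<cdot>\<^bsub>B\<^esub> \<phi> (Dom A f))"

text \<open>The union below is itself a wide subcategory on which \<open>\<phi>\<close> is natural, hence the largest.\<close>

definition nat_part ::
    "('o, 'a, 'z) cat_scheme \<Rightarrow> ('p, 'b, 'y) cat_scheme \<Rightarrow> ('o, 'a, 'p, 'b) func \<Rightarrow>
     ('o, 'a, 'p, 'b) func \<Rightarrow> ('o \<Rightarrow> 'b) \<Rightarrow> 'a set" where
  "nat_part A B G H \<phi> = \<Union>{S. wide_subcategory A S \<and> natural_on A B G H \<phi> S}"

definition natural ::
    "('o, 'a, 'z) cat_scheme \<Rightarrow> ('p, 'b, 'y) cat_scheme \<Rightarrow> ('o, 'a, 'p, 'b) func \<Rightarrow>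
     ('o, 'a, 'p, 'b) func \<Rightarrow> ('o \<Rightarrow> 'b) \<Rightarrow> bool" where
  "natural A B G H \<phi> \<longleftrightarrow> infranatural A B G H \<phi> \<and> natural_on A B G H \<phi> (Ar A)"

definition natural_iso ::
    "('o, 'a, 'z) cat_scheme \<Rightarrow> ('p, 'b, 'y) cat_scheme \<Rightarrow> ('o, 'a, 'p, 'b) func \<Rightarrow>
     ('o, 'a, 'p, 'b) func \<Rightarrow> ('o \<Rightarrow> 'b) \<Rightarrow> bool" where
  "natural_iso A B G H \<phi> \<longleftrightarrow> natural A B G H \<phi> \<and> (\<forall>X \<in> Ob A. iso_ar B (\<phi> X))"


section \<open>P-categories\<close>

record ('o, 'a) pcat = "('o, 'a) cat" +
  boxO :: "'o \<Rightarrow> 'o \<Rightarrow> 'o" (infixr "\<box>\<index>" 80)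
  boxA :: "'a \<Rightarrow> 'a \<Rightarrow> 'a" (infixr "\<boxtimes>\<index>" 80)
  diag :: "'o \<Rightarrow> 'a"
  proj0 :: "'o \<Rightarrow> 'o \<Rightarrow> 'a"
  proj1 :: "'o \<Rightarrow> 'o \<Rightarrow> 'a"

definition box_func :: "('o, 'a, 'z) pcat_scheme \<Rightarrow> ('o \<times> 'o, 'a \<times> 'a, 'o, 'a) func" where
  "box_func Q = \<lparr>FOb = (\<lambda>(X, Y). X \<box>\<^bsub>Q\<^esub> Y), FAr = (\<lambda>(f, g). f \<boxtimes>\<^bsub>Q\<^esub> g)\<rparr>"

definition pair_ar :: "('o, 'a, 'z) pcat_scheme \<Rightarrow> 'a \<Rightarrow> 'a \<Rightarrow> 'a" where
  "pair_ar Q f g = (f \<boxtimes>\<^bsub>Q\<^esub> g) \<cdot>\<^bsub>Q\<^esub> diag Q (Dom Q f)"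

definition assoc_ar :: "('o, 'a, 'z) pcat_scheme \<Rightarrow> 'o \<Rightarrow> 'o \<Rightarrow> 'o \<Rightarrow> 'a" where
  "assoc_ar Q X Y Z =
     pair_ar Q (proj0 Q X Y \<cdot>\<^bsub>Q\<^esub> proj0 Q (X \<box>\<^bsub>Q\<^esub> Y) Z)
       (pair_ar Q (proj1 Q X Y \<cdot>\<^bsub>Q\<^esub> proj0 Q (X \<box>\<^bsub>Q\<^esub> Y) Z) (proj1 Q (X \<box>\<^bsub>Q\<^esub> Y) Z))"

definition symm_ar :: "('o, 'a, 'z) pcat_scheme \<Rightarrow> 'o \<Rightarrow> 'o \<Rightarrow> 'a" where
  "symm_ar Q X Y = pair_ar Q (proj1 Q X Y) (proj0 Q X Y)"

text \<open>The smallest subcategory closed under \<open>\<boxtimes>\<close> that contains the components of the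
  projections.\<close>

definition proj_subcat :: "('o, 'a, 'z) pcat_scheme \<Rightarrow> 'a set" where
  "proj_subcat Q = \<Inter>{S. subcategory Q S \<and>
     (\<forall>f \<in> S. \<forall>g \<in> S. f \<boxtimes>\<^bsub>Q\<^esub> g \<in> S) \<and>
     (\<forall>X \<in> Ob Q. \<forall>Y \<in> Ob Q. proj0 Q X Y \<in> S \<and> proj1 Q X Y \<in> S)}"

locale p_category = category Q for Q :: "('o, 'a, 'z) pcat_scheme" (structure) +
  assumes box_functor: "is_functor (Q \<times>\<^sub>C Q) Q (box_func Q)"
    and diag_natural:
      "natural Q Q id_func \<lparr>FOb = (\<lambda>X. X \<box> X), FAr = (\<lambda>f. f \<boxtimes> f)\<rparr> (diag Q)"
    and proj0_infranatural:
      "infranatural (Q \<times>\<^sub>C Q) Q (box_func Q) \<lparr>FOb = fst, FAr = fst\<rparr> (case_prod (proj0 Q))"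
    and proj1_infranatural:
      "infranatural (Q \<times>\<^sub>C Q) Q (box_func Q) \<lparr>FOb = snd, FAr = snd\<rparr> (case_prod (proj1 Q))"
    and proj0_diag: "X \<in> Ob Q \<Longrightarrow> proj0 Q X X \<cdot> diag Q X = Idn Q X"
    and proj1_diag: "X \<in> Ob Q \<Longrightarrow> proj1 Q X X \<cdot> diag Q X = Idn Q X"
    and proj_box_diag: "\<lbrakk>X \<in> Ob Q; Y \<in> Ob Q\<rbrakk> \<Longrightarrow>
      (proj0 Q X Y \<boxtimes> proj1 Q X Y) \<cdot> diag Q (X \<box> Y) = Idn Q (X \<box> Y)"
    and proj0_nat: "Ar Q \<times> proj_subcat Q \<subseteq>
      nat_part (Q \<times>\<^sub>C Q) Q (box_func Q) \<lparr>FOb = fst, FAr = fst\<rparr> (case_prod (proj0 Q))"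
    and proj1_nat: "proj_subcat Q \<times> Ar Q \<subseteq>
      nat_part (Q \<times>\<^sub>C Q) Q (box_func Q) \<lparr>FOb = snd, FAr = snd\<rparr> (case_prod (proj1 Q))"
    and assoc_natural_iso:
      "natural_iso (Q \<times>\<^sub>C Q \<times>\<^sub>C Q) Q
         \<lparr>FOb = (\<lambda>(X, Y, Z). (X \<box> Y) \<box> Z), FAr = (\<lambda>(f, g, h). (f \<boxtimes> g) \<boxtimes> h)\<rparr>
         \<lparr>FOb = (\<lambda>(X, Y, Z). X \<box> (Y \<box> Z)), FAr = (\<lambda>(f, g, h). f \<boxtimes> (g \<boxtimes> h))\<rparr>
         (\<lambda>(X, Y, Z). assoc_ar Q X Y Z)"
    and symm_natural_iso:
      "natural_iso (Q \<times>\<^sub>C Q) Q (box_func Q)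
         \<lparr>FOb = (\<lambda>(X, Y). Y \<box> X), FAr = (\<lambda>(f, g). g \<boxtimes> f)\<rparr>
         (\<lambda>(X, Y). symm_ar Q X Y)"
    and pentagon: "\<lbrakk>W \<in> Ob Q; X \<in> Ob Q; Y \<in> Ob Q; Z \<in> Ob Q\<rbrakk> \<Longrightarrow>
      assoc_ar Q W X (Y \<box> Z) \<cdot> assoc_ar Q (W \<box> X) Y Z =
      (Idn Q W \<boxtimes> assoc_ar Q X Y Z) \<cdot> assoc_ar Q W (X \<box> Y) Z \<cdot> (assoc_ar Q W X Y \<boxtimes> Idn Q Z)"
    and hexagon: "\<lbrakk>X \<in> Ob Q; Y \<in> Ob Q; Z \<in> Ob Q\<rbrakk> \<Longrightarrow>
      assoc_ar Q Y Z X \<cdot> symm_ar Q X (Y \<box> Z) \<cdot> assoc_ar Q X Y Z =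
      (Idn Q Y \<boxtimes> symm_ar Q X Z) \<cdot> assoc_ar Q Y X Z \<cdot> (symm_ar Q X Y \<boxtimes> Idn Q Z)"
    and symmetry: "\<lbrakk>X \<in> Ob Q; Y \<in> Ob Q\<rbrakk> \<Longrightarrow>
      symm_ar Q Y X \<cdot> symm_ar Q X Y = Idn Q (X \<box> Y)"

definition dom_ar :: "('o, 'a, 'z) pcat_scheme \<Rightarrow> 'a \<Rightarrow> 'a" where
  "dom_ar Q \<phi> = proj0 Q (Dom Q \<phi>) (Cod Q \<phi>) \<cdot>\<^bsub>Q\<^esub> pair_ar Q (Idn Q (Dom Q \<phi>)) \<phi>"

definition total_ar :: "('o, 'a, 'z) pcat_scheme \<Rightarrow> 'a \<Rightarrow> bool" where
  "total_ar Q \<phi> \<longleftrightarrow> dom_ar Q \<phi> = Idn Q (Dom Q \<phi>)"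


section \<open>Prodominical and dominical categories\<close>

definition zero_system :: "('o, 'a, 'z) cat_scheme \<Rightarrow> ('o \<Rightarrow> 'o \<Rightarrow> 'a) \<Rightarrow> bool" where
  "zero_system C z \<longleftrightarrow>
     (\<forall>X \<in> Ob C. \<forall>Y \<in> Ob C. z X Y \<in> hom C X Y) \<and>
     (\<forall>f \<in> Ar C. \<forall>g \<in> Ar C.
        g \<cdot>\<^bsub>C\<^esub> z (Cod C f) (Dom C g) \<cdot>\<^bsub>C\<^esub> f = z (Dom C f) (Cod C g))"

definition prodominical :: "('o, 'a, 'z) pcat_scheme \<Rightarrow> bool" where
  "prodominical Q \<longleftrightarrow> p_category Q \<and>
     (\<exists>z. zero_system Q z \<and>
        (\<forall>\<phi> \<in> Ar Q. \<forall>X \<in> Ob Q. \<forall>Y \<in> Ob Q.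
           \<phi> \<boxtimes>\<^bsub>Q\<^esub> z X Y = z (Dom Q \<phi> \<box>\<^bsub>Q\<^esub> X) (Cod Q \<phi> \<box>\<^bsub>Q\<^esub> Y)))"

definition weakly_total ::
    "('o, 'a, 'z) cat_scheme \<Rightarrow> ('o \<Rightarrow> 'o \<Rightarrow> 'a) \<Rightarrow> 'a \<Rightarrow> bool" where
  "weakly_total C z f \<longleftrightarrow>
     (\<forall>\<phi> \<in> Ar C. Cod C \<phi> = Dom C f \<longrightarrow>
        f \<cdot>\<^bsub>C\<^esub> \<phi> = z (Dom C \<phi>) (Cod C f) \<longrightarrow> \<phi> = z (Dom C \<phi>) (Dom C f))"

text \<open>A system of zero morphisms is unique on objects, so the universal quantifier over \<open>z\<close>
  ranges over exactly one system.\<close>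

definition dominical :: "('o, 'a, 'z) pcat_scheme \<Rightarrow> bool" where
  "dominical Q \<longleftrightarrow> prodominical Q \<and>
     (\<forall>z. zero_system Q z \<longrightarrow>
        (\<forall>f \<in> Ar Q. weakly_total Q z f \<longrightarrow> total_ar Q f) \<and>
        (\<forall>\<phi> \<in> Ar Q. \<forall>\<psi> \<in> Ar Q.
           \<phi> \<boxtimes>\<^bsub>Q\<^esub> \<psi> = z (Dom Q \<phi> \<box>\<^bsub>Q\<^esub> Dom Q \<psi>) (Cod Q \<phi> \<box>\<^bsub>Q\<^esub> Cod Q \<psi>) \<longrightarrow>
           \<phi> = z (Dom Q \<phi>) (Cod Q \<phi>) \<or> \<psi> = z (Dom Q \<psi>) (Cod Q \<psi>)))"


section \<open>Partial morphisms of a category\<close>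

text \<open>The product cone is picked by Hilbert choice: \<open>prod_ob\<close>, \<open>prod_p0\<close>, \<open>prod_p1\<close> are
  meaningful only where a product exists.\<close>

definition prod_cone :: "('o, 'a, 'z) cat_scheme \<Rightarrow> 'o \<Rightarrow> 'o \<Rightarrow> 'o \<times> 'a \<times> 'a" where
  "prod_cone C X Y = (SOME c. is_product C X Y c)"

definition prod_ob :: "('o, 'a, 'z) cat_scheme \<Rightarrow> 'o \<Rightarrow> 'o \<Rightarrow> 'o" where
  "prod_ob C X Y = fst (prod_cone C X Y)"

definition prod_p0 :: "('o, 'a, 'z) cat_scheme \<Rightarrow> 'o \<Rightarrow> 'o \<Rightarrow> 'a" where
  "prod_p0 C X Y = fst (snd (prod_cone C X Y))"

definition prod_p1 :: "('o, 'a, 'z) cat_scheme \<Rightarrow> 'o \<Rightarrow> 'o \<Rightarrow> 'a" where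
  "prod_p1 C X Y = snd (snd (prod_cone C X Y))"

definition prod_ar :: "('o, 'a, 'z) cat_scheme \<Rightarrow> 'a \<Rightarrow> 'a \<Rightarrow> 'a" where
  "prod_ar C f g = (let U = Dom C f; V = Dom C g; X = Cod C f; Y = Cod C g in
     THE h. h \<in> hom C (prod_ob C U V) (prod_ob C X Y) \<and>
       prod_p0 C X Y \<cdot>\<^bsub>C\<^esub> h = f \<cdot>\<^bsub>C\<^esub> prod_p0 C U V \<and>
       prod_p1 C X Y \<cdot>\<^bsub>C\<^esub> h = g \<cdot>\<^bsub>C\<^esub> prod_p1 C U V)"

definition prod_diag :: "('o, 'a, 'z) cat_scheme \<Rightarrow> 'o \<Rightarrow> 'a" where
  "prod_diag C X = (THE h. h \<in> hom C X (prod_ob C X X) \<and>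
     prod_p0 C X X \<cdot>\<^bsub>C\<^esub> h = Idn C X \<and> prod_p1 C X X \<cdot>\<^bsub>C\<^esub> h = Idn C X)"

definition pspans :: "('o, 'a, 'z) cat_scheme \<Rightarrow> ('a \<times> 'a) set" where
  "pspans C = {(m, \<phi>). mono_ar C m \<and> \<phi> \<in> Ar C \<and> Dom C \<phi> = Dom C m}"

definition pspan_rel :: "('o, 'a, 'z) cat_scheme \<Rightarrow> (('a \<times> 'a) \<times> ('a \<times> 'a)) set" where
  "pspan_rel C = {((m, \<phi>), (m', \<phi>')). (m, \<phi>) \<in> pspans C \<and> (m', \<phi>') \<in> pspans C \<and>
     (\<exists>\<theta> \<in> hom C (Dom C m) (Dom C m'). iso_ar C \<theta> \<and>
        m = m' \<cdot>\<^bsub>C\<^esub> \<theta> \<and> \<phi> = \<phi>' \<cdot>\<^bsub>C\<^esub> \<theta>)}"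

definition pclass :: "('o, 'a, 'z) cat_scheme \<Rightarrow> 'a \<Rightarrow> 'a \<Rightarrow> ('a \<times> 'a) set" where
  "pclass C m \<phi> = pspan_rel C `` {(m, \<phi>)}"

text \<open>Composition and \<open>\<boxtimes>\<close> of classes are the unions of the classes obtained from all
  representatives (and all pullbacks).  Each of these unions consists of a single class whenever
  \<open>C\<close> has pullbacks and binary products.\<close>

definition Pfn :: "('o, 'a, 'z) cat_scheme \<Rightarrow> ('o, ('a \<times> 'a) set) pcat" where
  "Pfn C =
     \<lparr>Ob = Ob C,
      Ar = pspans C // pspan_rel C,
      Dom = (\<lambda>c. the_elem ((\<lambda>(m, \<phi>). Cod C m) ` c)),
      Cod = (\<lambda>c. the_elem ((\<lambda>(m, \<phi>). Cod C \<phi>) ` c)),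
      Idn = (\<lambda>X. pclass C (Idn C X) (Idn C X)),
      Comp = (\<lambda>c' c. \<Union>{pclass C (m \<cdot>\<^bsub>C\<^esub> q) (\<phi>' \<cdot>\<^bsub>C\<^esub> r) | m \<phi> m' \<phi>' q r.
                (m, \<phi>) \<in> c \<and> (m', \<phi>') \<in> c' \<and> is_pullback C \<phi> m' q r}),
      boxO = prod_ob C,
      boxA = (\<lambda>c c'. \<Union>{pclass C (prod_ar C m m') (prod_ar C \<phi> \<phi>') | m \<phi> m' \<phi>'.
                (m, \<phi>) \<in> c \<and> (m', \<phi>') \<in> c'}),
      diag = (\<lambda>X. pclass C (Idn C X) (prod_diag C X)),
      proj0 = (\<lambda>X Y. pclass C (Idn C (prod_ob C X Y)) (prod_p0 C X Y)),
      proj1 = (\<lambda>X Y. pclass C (Idn C (prod_ob C X Y)) (prod_p1 C X Y))\<rparr>"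


section \<open>Sets and coalgebras\<close>

datatype ('o, 'f) arrow = Arrow (src: 'o) (body: 'f) (tgt: 'o)

text \<open>HOL has no type of all sets, so \<open>Set\<close> is taken relative to a collection \<open>\<U>\<close> of subsets
  of an arbitrary type, whose members are the sets of the category. Only the closure properties
  below are required. They hold for all subsets of an infinite type, and for the small subsets
  of a model \<open>V\<close> of set theory, i.e. those of the form \<open>{x. x \<in>\<^sub>V a}\<close> for some \<open>a\<close> in \<open>V\<close>; the
  latter gives the usual category of sets.\<close>

locale set_universe =
  fixes \<U> :: "'u set set"
  assumes subset_closed: "\<lbrakk>A \<in> \<U>; B \<subseteq> A\<rbrakk> \<Longrightarrow> B \<in> \<U>"
    and times_closed: "\<lbrakk>A \<in> \<U>; B \<in> \<U>\<rbrakk> \<Longrightarrow> \<exists>P \<in> \<U>. P \<approx> A \<times> B"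
    and two_element_set: "\<exists>A \<in> \<U>. card A = 2"

definition SET :: "'u set set \<Rightarrow> ('u set, ('u set, 'u \<Rightarrow> 'u) arrow) cat" where
  "SET \<U> =
     \<lparr>Ob = \<U>,
      Ar = {Arrow A f B | A f B. A \<in> \<U> \<and> B \<in> \<U> \<and> f \<in> A \<rightarrow>\<^sub>E B},
      Dom = src,
      Cod = tgt,
      Idn = (\<lambda>A. Arrow A (restrict id A) A),
      Comp = (\<lambda>g f. Arrow (src f) (compose (src f) (body g) (body f)) (tgt g))\<rparr>"

definition Coalg ::
    "('o, 'a, 'z) cat_scheme \<Rightarrow> ('o, 'a, 'o, 'a) func \<Rightarrow> ('o \<times> 'a, ('o \<times> 'a, 'a) arrow) cat" where
  "Coalg C F = (let Obs = {(A, \<alpha>). A \<in> Ob C \<and> \<alpha> \<in> hom C A (FOb F A)} in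
     \<lparr>Ob = Obs,
      Ar = {Arrow (A, \<alpha>) \<phi> (B, \<beta>) | A \<alpha> \<phi> B \<beta>.
              (A, \<alpha>) \<in> Obs \<and> (B, \<beta>) \<in> Obs \<and> \<phi> \<in> hom C A B \<and>
              \<beta> \<cdot>\<^bsub>C\<^esub> \<phi> = FAr F \<phi> \<cdot>\<^bsub>C\<^esub> \<alpha>},
      Dom = src,
      Cod = tgt,
      Idn = (\<lambda>X. Arrow X (Idn C (fst X)) X),
      Comp = (\<lambda>g f. Arrow (src f) (body g \<cdot>\<^bsub>C\<^esub> body f) (tgt g))\<rparr>)"

end

theory Submission
  imports Defs
begin

text \<open>
  A coalgebra of the identity functor is a set with an endomap, and its subobjects are the subsets
  that the endomap maps into themselves. A partial morphism from \<open>X\<close> to \<open>Y\<close> is therefore the same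
  thing as a single-valued relation \<open>R \<subseteq> X \<times> Y\<close> that is invariant, i.e. closed under the two
  endomaps applied in parallel: the spans \<open>(m, \<phi>)\<close> in its class are those whose legs jointly biject
  their source with \<open>R\<close>. Such a span is said to tabulate \<open>R\<close>. Invariant relations always have
  tabulations (\<open>tabulation_exists\<close>), and tabulations are exactly the spans with the corresponding
  universal property (\<open>tabulates_universal\<close>, \<open>universal_tabulates\<close>). This one fact describes products,
  pullbacks and kernel pairs by their points, although points of a set with an endomap are not
  morphisms into it.

  Under the dictionary (\<open>pclass_eq_cls\<close>, \<open>Ar_P\<close>) composition becomes relational composition
  (\<open>Comp_P\<close>), \<open>\<boxtimes>\<close> acts componentwise (\<open>Box_P\<close>), and diagonals, projections and the coherence
  isomorphisms become graphs of functions. The axioms of a P-category are then checked on points, and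
  the empty relation serves as the zero morphism.

  Dominicality fails because a proper subobject can meet every nonempty invariant subset. Let
  \<open>X = {a, b}\<close> with both elements mapped to \<open>b\<close>. Every nonempty invariant subset of \<open>X\<close> contains
  \<open>b\<close>, so the partial identity defined only at \<open>b\<close> has a nonzero composite with every nonzero morphism
  into \<open>X\<close>: it is weakly total, but not total.
\<close>

section \<open>Product categories and wide subcategories\<close>

lemma id_func_sel [simp]: "FOb id_func X = X" "FAr id_func f = f"
  by (simp_all add: id_func_def)

lemma prod_cat_sel [simp]:
  "Ob (A \<times>\<^sub>C B) = Ob A \<times> Ob B" "Ar (A \<times>\<^sub>C B) = Ar A \<times> Ar B"
  "Dom (A \<times>\<^sub>C B) (f, g) = (Dom A f, Dom B g)" "Cod (A \<times>\<^sub>C B) (f, g) = (Cod A f, Cod B g)"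
  "Idn (A \<times>\<^sub>C B) (X, Y) = (Idn A X, Idn B Y)"
  "(f', g') \<cdot>\<^bsub>A \<times>\<^sub>C B\<^esub> (f, g) = (f' \<cdot>\<^bsub>A\<^esub> f, g' \<cdot>\<^bsub>B\<^esub> g)"
  by (simp_all add: prod_cat_def)

lemma (in category) wide_Ar: "wide_subcategory C (Ar C)"
proof -
  have "Idn C X \<in> Ar C" if "X \<in> Ob C" for X
    using idn_hom[OF that] by (simp add: hom_def)
  moreover have "g \<cdot> f \<in> Ar C" if "f \<in> Ar C" "g \<in> Ar C" "Dom C g = Cod C f" for f g
    using comp_hom[of f "Dom C f" "Cod C f" g "Cod C g"] that by (simp add: hom_def)
  ultimately show ?thesis
    using dom_ob cod_ob unfolding wide_subcategory_def subcategory_def by blast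
qed

lemma wide_prod:
  assumes "wide_subcategory A S" "wide_subcategory B T"
  shows "wide_subcategory (A \<times>\<^sub>C B) (S \<times> T)"
  using assms unfolding wide_subcategory_def subcategory_def by auto


section \<open>Sets with an endomap\<close>

type_synonym 'u setar = "('u set, 'u \<Rightarrow> 'u) arrow"
type_synonym 'u dyn = "'u set \<times> 'u setar"
type_synonym 'u dynar = "('u dyn, 'u setar) arrow"

definition car :: "'u dyn \<Rightarrow> 'u set" where
  "car X = fst X"

definition act :: "'u dyn \<Rightarrow> 'u \<Rightarrow> 'u" where
  "act X = body (snd X)"

definition fn :: "'u dynar \<Rightarrow> 'u \<Rightarrow> 'u" where
  "fn h = body (body h)"

definition dyn_of :: "'u set \<Rightarrow> ('u \<Rightarrow> 'u) \<Rightarrow> 'u dyn" where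
  "dyn_of A f = (A, Arrow A (restrict f A) A)"

definition dynar_of :: "'u dyn \<Rightarrow> ('u \<Rightarrow> 'u) \<Rightarrow> 'u dyn \<Rightarrow> 'u dynar" where
  "dynar_of X f Y = Arrow X (Arrow (car X) (restrict f (car X)) (car Y)) Y"

definition equivariant :: "'u dyn \<Rightarrow> 'u dyn \<Rightarrow> ('u \<Rightarrow> 'u) \<Rightarrow> bool" where
  "equivariant X Y f \<longleftrightarrow> f \<in> car X \<rightarrow> car Y \<and> (\<forall>x\<in>car X. f (act X x) = act Y (f x))"

lemma car_dyn_of [simp]: "car (dyn_of A f) = A"
  by (simp add: car_def dyn_of_def)

lemma act_dyn_of [simp]: "x \<in> A \<Longrightarrow> act (dyn_of A f) x = f x"
  by (simp add: act_def dyn_of_def)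

lemma fn_dynar_of [simp]: "x \<in> car X \<Longrightarrow> fn (dynar_of X f Y) x = f x"
  by (simp add: fn_def dynar_of_def)

context set_universe
begin

abbreviation D :: "('u dyn, 'u dynar) cat" where
  "D \<equiv> Coalg (SET \<U>) id_func"

lemma SET_hom: "h \<in> hom (SET \<U>) A B \<longleftrightarrow>
   A \<in> \<U> \<and> B \<in> \<U> \<and> (\<exists>f. f \<in> A \<rightarrow>\<^sub>E B \<and> h = Arrow A f B)"
  by (auto simp: hom_def SET_def)

lemma Ob_SET [simp]: "Ob (SET \<U>) = \<U>"
  by (simp add: SET_def)

lemma Dom_D [simp]: "Dom D f = src f" and Cod_D [simp]: "Cod D f = tgt f"
  by (simp_all add: Coalg_def Let_def)

lemma Ob_D: "X \<in> Ob D \<longleftrightarrow> (\<exists>A f. A \<in> \<U> \<and> f \<in> A \<rightarrow> A \<and> X = dyn_of A f)"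
proof
  assume "X \<in> Ob D"
  then obtain A f where "A \<in> \<U>" "f \<in> A \<rightarrow>\<^sub>E A" "X = (A, Arrow A f A)"
    by (auto simp: Coalg_def Let_def SET_hom id_func_def)
  then have "A \<in> \<U> \<and> f \<in> A \<rightarrow> A \<and> X = dyn_of A f"
    by (auto simp: dyn_of_def PiE_restrict)
  then show "\<exists>A f. A \<in> \<U> \<and> f \<in> A \<rightarrow> A \<and> X = dyn_of A f"
    by blast
next
  assume "\<exists>A f. A \<in> \<U> \<and> f \<in> A \<rightarrow> A \<and> X = dyn_of A f"
  then show "X \<in> Ob D"
    by (auto simp: Coalg_def Let_def SET_hom id_func_def dyn_of_def restrict_PiE_iff)
qed

lemma car_mem [intro]: "X \<in> Ob D \<Longrightarrow> car X \<in> \<U>"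
  by (auto simp: Ob_D)

lemma act_closed [intro, simp]: "\<lbrakk>X \<in> Ob D; x \<in> car X\<rbrakk> \<Longrightarrow> act X x \<in> car X"
  by (auto simp: Ob_D)

lemma dyn_of_Ob [intro]: "\<lbrakk>A \<in> \<U>; f \<in> A \<rightarrow> A\<rbrakk> \<Longrightarrow> dyn_of A f \<in> Ob D"
  by (auto simp: Ob_D)

lemma hom_D: "h \<in> hom D X Y \<longleftrightarrow> X \<in> Ob D \<and> Y \<in> Ob D \<and>
    (\<exists>f. equivariant X Y f \<and> h = dynar_of X f Y)"  (is "?l \<longleftrightarrow> ?r")
proof -
  have *: "?l \<longleftrightarrow> ?r" if XY: "X \<in> Ob D" "Y \<in> Ob D"
  proof -
    obtain A \<alpha> B \<beta> where X: "A \<in> \<U>" "\<alpha> \<in> A \<rightarrow> A" "X = dyn_of A \<alpha>"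
      and Y: "B \<in> \<U>" "\<beta> \<in> B \<rightarrow> B" "Y = dyn_of B \<beta>"
      using XY unfolding Ob_D by blast
    have c: "compose A (restrict \<beta> B) f = compose A f (restrict \<alpha> A) \<longleftrightarrow>
        (\<forall>x\<in>A. f (\<alpha> x) = \<beta> (f x))" if "f \<in> A \<rightarrow> B" for f
      using that by (auto simp: compose_def fun_eq_iff Pi_iff)
    have "?l \<longleftrightarrow> (\<exists>f. f \<in> A \<rightarrow>\<^sub>E B \<and> h = Arrow X (Arrow A f B) Y \<and>
        compose A (restrict \<beta> B) f = compose A f (restrict \<alpha> A))"
      using XY X(1,3) Y(1,3)
      by (auto simp: hom_def Coalg_def Let_def id_func_def SET_def dyn_of_def)
    also have "\<dots> \<longleftrightarrow> (\<exists>f. f \<in> A \<rightarrow>\<^sub>E B \<and> h = Arrow X (Arrow A f B) Y \<and>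
        (\<forall>x\<in>A. f (\<alpha> x) = \<beta> (f x)))"
      by (intro ex_cong1 conj_cong refl c) auto
    also have "\<dots> \<longleftrightarrow> (\<exists>f. equivariant X Y f \<and> h = dynar_of X f Y)"
    proof safe
      fix f assume f: "f \<in> A \<rightarrow>\<^sub>E B" "\<forall>x\<in>A. f (\<alpha> x) = \<beta> (f x)"
      then have "equivariant X Y f" "Arrow X (Arrow A f B) Y = dynar_of X f Y"
        using X Y PiE_mem[OF f(1)]
        by (auto simp: equivariant_def dynar_of_def PiE_restrict Pi_iff)
      then show "\<exists>g. equivariant X Y g \<and> Arrow X (Arrow A f B) Y = dynar_of X g Y"
        by blast
    next
      fix f assume "equivariant X Y f"
      then have "restrict f A \<in> A \<rightarrow>\<^sub>E B" "\<forall>x\<in>A. restrict f A (\<alpha> x) = \<beta> (restrict f A x)"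
        using X Y by (auto simp: equivariant_def Pi_iff)
      moreover have "dynar_of X f Y = Arrow X (Arrow A (restrict f A) B) Y"
        using X Y by (simp add: dynar_of_def)
      ultimately show "\<exists>g. g \<in> A \<rightarrow>\<^sub>E B \<and> dynar_of X f Y = Arrow X (Arrow A g B) Y \<and>
          (\<forall>x\<in>A. g (\<alpha> x) = \<beta> (g x))"
        by blast
    qed
    finally show ?thesis
      using XY by blast
  qed
  have "X \<in> Ob D \<and> Y \<in> Ob D" if ?l
    using that by (auto simp: hom_def Coalg_def Let_def)
  with * show ?thesis
    by blast
qed

lemma dynar_of_hom [intro]:
  "\<lbrakk>X \<in> Ob D; Y \<in> Ob D; equivariant X Y f\<rbrakk> \<Longrightarrow> dynar_of X f Y \<in> hom D X Y"
  by (auto simp: hom_D)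

lemma homD:
  assumes "h \<in> hom D X Y"
  shows "X \<in> Ob D" "Y \<in> Ob D" "h \<in> Ar D" "src h = X" "tgt h = Y"
    "x \<in> car X \<Longrightarrow> fn h x \<in> car Y"
    "x \<in> car X \<Longrightarrow> fn h (act X x) = act Y (fn h x)"
proof -
  show XY: "X \<in> Ob D" "Y \<in> Ob D"
    using assms by (auto simp: hom_D)
  show "h \<in> Ar D" "src h = X" "tgt h = Y"
    using assms by (auto simp: hom_def)
  obtain f where "equivariant X Y f" "h = dynar_of X f Y"
    using assms by (auto simp: hom_D)
  then show "x \<in> car X \<Longrightarrow> fn h x \<in> car Y"
    and "x \<in> car X \<Longrightarrow> fn h (act X x) = act Y (fn h x)"
    using XY by (auto simp: equivariant_def)
qed

lemma hom_eqI:
  assumes "h \<in> hom D X Y" "k \<in> hom D X Y" "\<And>x. x \<in> car X \<Longrightarrow> fn h x = fn k x"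
  shows "h = k"
proof -
  obtain f g where fg: "h = dynar_of X f Y" "k = dynar_of X g Y"
    using assms(1,2) by (auto simp: hom_D)
  have "f x = g x" if "x \<in> car X" for x
    using assms(3)[OF that] that fg by simp
  then have "restrict f (car X) = restrict g (car X)"
    by (rule restrict_ext)
  then show ?thesis
    by (simp add: fg dynar_of_def)
qed

lemma Ar_hom: "h \<in> Ar D \<Longrightarrow> h \<in> hom D (src h) (tgt h)"
  by (simp add: hom_def)

lemma Idn_hom [intro]: "X \<in> Ob D \<Longrightarrow> Idn D X \<in> hom D X X"
  and fn_Idn [simp]: "\<lbrakk>X \<in> Ob D; x \<in> car X\<rbrakk> \<Longrightarrow> fn (Idn D X) x = x"
proof -
  assume X: "X \<in> Ob D"
  have "Idn D X = dynar_of X id X"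
    by (simp add: Coalg_def Let_def SET_def dynar_of_def car_def)
  with X show "Idn D X \<in> hom D X X" and "x \<in> car X \<Longrightarrow> fn (Idn D X) x = x"
    by (auto simp: equivariant_def)
qed

lemma Comp_hom [intro]:
    "\<lbrakk>f \<in> hom D X Y; g \<in> hom D Y Z\<rbrakk> \<Longrightarrow> g \<cdot>\<^bsub>D\<^esub> f \<in> hom D X Z"
  and fn_Comp [simp]:
    "\<lbrakk>f \<in> hom D X Y; g \<in> hom D Y Z; x \<in> car X\<rbrakk> \<Longrightarrow> fn (g \<cdot>\<^bsub>D\<^esub> f) x = fn g (fn f x)"
proof -
  assume f: "f \<in> hom D X Y" and g: "g \<in> hom D Y Z"
  obtain f' g' where f': "equivariant X Y f'" "f = dynar_of X f' Y"
    and g': "equivariant Y Z g'" "g = dynar_of Y g' Z" and XYZ: "X \<in> Ob D" "Z \<in> Ob D"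
    using f g by (auto simp: hom_D)
  have "compose (car X) (restrict g' (car Y)) (restrict f' (car X)) =
      restrict (\<lambda>x. g' (f' x)) (car X)"
    using f' by (auto simp: compose_def equivariant_def fun_eq_iff)
  then have e: "g \<cdot>\<^bsub>D\<^esub> f = dynar_of X (\<lambda>x. g' (f' x)) Z"
    by (simp add: Coalg_def Let_def SET_def f' g' dynar_of_def)
  show "g \<cdot>\<^bsub>D\<^esub> f \<in> hom D X Z" and "x \<in> car X \<Longrightarrow> fn (g \<cdot>\<^bsub>D\<^esub> f) x = fn g (fn f x)"
    unfolding e using f' g' XYZ by (auto simp: equivariant_def Pi_iff)
qed

lemma comp_eq_iff:
  assumes f: "f \<in> hom D X Y" and g: "g \<in> hom D Y Z" and h: "h \<in> hom D X Z"
  shows "g \<cdot>\<^bsub>D\<^esub> f = h \<longleftrightarrow> (\<forall>x\<in>car X. fn g (fn f x) = fn h x)"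
  using fn_Comp[OF f g] hom_eqI[OF Comp_hom[OF f g] h] by auto

lemma comp_eq_comp_iff:
  assumes f: "f \<in> hom D X Y" and g: "g \<in> hom D Y Z"
    and f': "f' \<in> hom D X Y'" and g': "g' \<in> hom D Y' Z"
  shows "g \<cdot>\<^bsub>D\<^esub> f = g' \<cdot>\<^bsub>D\<^esub> f' \<longleftrightarrow> (\<forall>x\<in>car X. fn g (fn f x) = fn g' (fn f' x))"
  using fn_Comp[OF f' g'] by (simp add: comp_eq_iff[OF f g Comp_hom[OF f' g']])


section \<open>Tabulations of invariant relations\<close>

definition invariant :: "'u dyn \<Rightarrow> 'u dyn \<Rightarrow> ('u \<times> 'u) set \<Rightarrow> bool" where
  "invariant X Y R \<longleftrightarrow> R \<subseteq> car X \<times> car Y \<and> (\<forall>(x, y)\<in>R. (act X x, act Y y) \<in> R)"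

definition tabulates ::
    "'u dyn \<Rightarrow> 'u dyn \<Rightarrow> ('u \<times> 'u) set \<Rightarrow> 'u dyn \<Rightarrow> 'u dynar \<Rightarrow> 'u dynar \<Rightarrow> bool" where
  "tabulates X Y R W q r \<longleftrightarrow> q \<in> hom D W X \<and> r \<in> hom D W Y \<and>
     bij_betw (\<lambda>w. (fn q w, fn r w)) (car W) R"

lemma tabulates_image: "tabulates X Y R W q r \<Longrightarrow> w \<in> car W \<Longrightarrow> (fn q w, fn r w) \<in> R"
  by (auto simp: tabulates_def bij_betw_def)

lemma tabulates_inj: "tabulates X Y R W q r \<Longrightarrow> w \<in> car W \<Longrightarrow> w' \<in> car W \<Longrightarrow>
    fn q w = fn q w' \<Longrightarrow> fn r w = fn r w' \<Longrightarrow> w = w'"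
  by (auto simp: tabulates_def bij_betw_def inj_on_def)

lemma tabulates_surj:
  assumes "tabulates X Y R W q r" "(x, y) \<in> R"
  obtains w where "w \<in> car W" "fn q w = x" "fn r w = y"
  using assms by (auto simp: tabulates_def bij_betw_def)

lemma tabulatesI:
  assumes "q \<in> hom D W X" "r \<in> hom D W Y"
    and "\<And>w. w \<in> car W \<Longrightarrow> (fn q w, fn r w) \<in> R"
    and "\<And>w w'. \<lbrakk>w \<in> car W; w' \<in> car W; fn q w = fn q w'; fn r w = fn r w'\<rbrakk> \<Longrightarrow> w = w'"
    and "\<And>x y. (x, y) \<in> R \<Longrightarrow> \<exists>w\<in>car W. fn q w = x \<and> fn r w = y"
  shows "tabulates X Y R W q r"
  unfolding tabulates_def
proof (intro conjI bij_betwI')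
  show "\<exists>w\<in>car W. z = (fn q w, fn r w)" if "z \<in> R" for z
    using assms(5)[of "fst z" "snd z"] that by (metis prod.collapse)
qed (use assms(1-4) in auto)

text \<open>The tabulating object is \<open>R\<close> itself with the two endomaps in parallel, carried over to a
  set of the universe: the universe contains a copy of the full product of the carriers, hence of its
  subset \<open>R\<close>.\<close>
lemma tabulation_exists:
  assumes X: "X \<in> Ob D" and Y: "Y \<in> Ob D" and R: "invariant X Y R"
  obtains W q r where "tabulates X Y R W q r"
proof -
  obtain P e where P: "P \<in> \<U>" and e: "bij_betw e P (car X \<times> car Y)"
    using times_closed[OF car_mem[OF X] car_mem[OF Y]] by (auto simp: eqpoll_def)
  define A where "A = {p \<in> P. e p \<in> R}"
  have A: "A \<in> \<U>"
    using subset_closed[OF P] by (simp add: A_def)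
  have eA: "bij_betw e A R"
    using R unfolding A_def invariant_def
    by (intro bij_betw_subset[OF e]) (auto simp: bij_betw_imp_surj_on[OF e, symmetric])
  define t where "t = (\<lambda>p. inv_into A e (act X (fst (e p)), act Y (snd (e p))))"
  define W where "W = dyn_of A t"
  have step: "(act X (fst (e p)), act Y (snd (e p))) \<in> R" if "p \<in> A" for p
    using R that unfolding A_def invariant_def by (auto split: prod.splits)
  have t: "t p \<in> A" "e (t p) = (act X (fst (e p)), act Y (snd (e p)))" if "p \<in> A" for p
    using step[OF that] eA unfolding t_def bij_betw_def
    by (auto intro: inv_into_into f_inv_into_f)
  have W: "W \<in> Ob D" "car W = A"
    using A t by (auto simp: W_def)
  have actW: "act W p = t p" if "p \<in> A" for p
    using that by (simp add: W_def)
  have R': "e p \<in> car X \<times> car Y" if "p \<in> A" for p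
    using R that by (auto simp: A_def invariant_def)
  have q: "dynar_of W (fst \<circ> e) X \<in> hom D W X"
    and r: "dynar_of W (snd \<circ> e) Y \<in> hom D W Y"
    using W X Y t R' actW by (force simp: equivariant_def)+
  have "bij_betw (\<lambda>w. (fn (dynar_of W (fst \<circ> e) X) w, fn (dynar_of W (snd \<circ> e) Y) w)) A R"
    by (rule iffD1[OF bij_betw_cong eA]) (simp add: W)
  then show ?thesis
    using that q r W(2) unfolding tabulates_def by blast
qed

lemma tabulates_universal:
  assumes T: "tabulates X Y R W q r"
    and s: "s \<in> hom D V X" and t: "t \<in> hom D V Y"
    and st: "\<And>v. v \<in> car V \<Longrightarrow> (fn s v, fn t v) \<in> R"
  shows "\<exists>!h. h \<in> hom D V W \<and> q \<cdot>\<^bsub>D\<^esub> h = s \<and> r \<cdot>\<^bsub>D\<^esub> h = t"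
proof -
  have q: "q \<in> hom D W X" and r: "r \<in> hom D W Y"
    using T by (auto simp: tabulates_def)
  have V: "V \<in> Ob D" and W: "W \<in> Ob D"
    using homD(1)[OF s] homD(1)[OF q] .
  obtain f where f: "\<And>v. v \<in> car V \<Longrightarrow> f v \<in> car W \<and> fn q (f v) = fn s v \<and> fn r (f v) = fn t v"
  proof -
    have "\<forall>v\<in>car V. \<exists>w. w \<in> car W \<and> fn q w = fn s v \<and> fn r w = fn t v"
    proof
      fix v assume "v \<in> car V"
      from tabulates_surj[OF T st[OF this]]
      show "\<exists>w. w \<in> car W \<and> fn q w = fn s v \<and> fn r w = fn t v"
        by blast
    qed
    from bchoice[OF this] show ?thesis
      using that by blast
  qed
  have "equivariant V W f"
    unfolding equivariant_def
  proof safe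
    fix v assume v: "v \<in> car V"
    show "f v \<in> car W"
      using f v by blast
    show "f (act V v) = act W (f v)"
      using f[OF v] f[OF act_closed[OF V v]] v V W
      by - (rule tabulates_inj[OF T], simp_all add: homD(7)[OF s] homD(7)[OF t] homD(7)[OF q] homD(7)[OF r])
  qed
  then have h: "dynar_of V f W \<in> hom D V W"
    using V W by blast
  have "h = k" if "h \<in> hom D V W" "q \<cdot>\<^bsub>D\<^esub> h = s" "r \<cdot>\<^bsub>D\<^esub> h = t"
    "k \<in> hom D V W" "q \<cdot>\<^bsub>D\<^esub> k = s" "r \<cdot>\<^bsub>D\<^esub> k = t" for h k
  proof (rule hom_eqI[OF that(1,4)])
    fix v assume v: "v \<in> car V"
    show "fn h v = fn k v"
      using that v homD(6)[OF that(1) v] homD(6)[OF that(4) v] fn_Comp[OF that(1) q v]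
        fn_Comp[OF that(1) r v] fn_Comp[OF that(4) q v] fn_Comp[OF that(4) r v]
      by - (rule tabulates_inj[OF T], auto)
  qed
  moreover have "q \<cdot>\<^bsub>D\<^esub> dynar_of V f W = s" "r \<cdot>\<^bsub>D\<^esub> dynar_of V f W = t"
    using f by (simp_all add: comp_eq_iff[OF h q s] comp_eq_iff[OF h r t])
  ultimately show ?thesis
    using h by blast
qed

text \<open>A cone with the universal property of a tabulation is isomorphic to an actual tabulation, so
  it is one. Comparing with a constructed cone replaces an argument by generalised points: elements
  correspond to morphisms from the free orbit, an infinite set that need not belong to the
  universe.\<close>
lemma universal_tabulates:
  assumes R: "invariant X Y R" and q: "q \<in> hom D W X" and r: "r \<in> hom D W Y"
    and qr: "\<And>w. w \<in> car W \<Longrightarrow> (fn q w, fn r w) \<in> R"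
    and univ: "\<And>V s t. \<lbrakk>s \<in> hom D V X; t \<in> hom D V Y; \<And>v. v \<in> car V \<Longrightarrow> (fn s v, fn t v) \<in> R\<rbrakk>
      \<Longrightarrow> \<exists>!h. h \<in> hom D V W \<and> q \<cdot>\<^bsub>D\<^esub> h = s \<and> r \<cdot>\<^bsub>D\<^esub> h = t"
  shows "tabulates X Y R W q r"
proof -
  have X: "X \<in> Ob D" and Y: "Y \<in> Ob D" and W: "W \<in> Ob D"
    using homD[OF q] homD[OF r] by auto
  obtain W' q' r' where T: "tabulates X Y R W' q' r'"
    using tabulation_exists[OF X Y R] .
  have q': "q' \<in> hom D W' X" and r': "r' \<in> hom D W' Y"
    using T by (auto simp: tabulates_def)
  obtain h where h: "h \<in> hom D W' W" "q \<cdot>\<^bsub>D\<^esub> h = q'" "r \<cdot>\<^bsub>D\<^esub> h = r'"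
    using univ[OF q' r' tabulates_image[OF T]] by blast
  obtain k where k: "k \<in> hom D W W'" "q' \<cdot>\<^bsub>D\<^esub> k = q" "r' \<cdot>\<^bsub>D\<^esub> k = r"
    using tabulates_universal[OF T q r qr] by blast
  have qh: "\<forall>w\<in>car W'. fn q (fn h w) = fn q' w" and rh: "\<forall>w\<in>car W'. fn r (fn h w) = fn r' w"
    using h comp_eq_iff q r q' r' by blast+
  have qk: "\<forall>w\<in>car W. fn q' (fn k w) = fn q w" and rk: "\<forall>w\<in>car W. fn r' (fn k w) = fn r w"
    using k comp_eq_iff q r q' r' by blast+
  have hk: "h \<cdot>\<^bsub>D\<^esub> k \<in> hom D W W" and id: "Idn D W \<in> hom D W W"
    using h k W by blast+
  have "q \<cdot>\<^bsub>D\<^esub> (h \<cdot>\<^bsub>D\<^esub> k) = q" "r \<cdot>\<^bsub>D\<^esub> (h \<cdot>\<^bsub>D\<^esub> k) = r"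
    "q \<cdot>\<^bsub>D\<^esub> Idn D W = q" "r \<cdot>\<^bsub>D\<^esub> Idn D W = r"
    using qh rh qk rk W homD(6)[OF k(1)]
    by (simp_all add: comp_eq_iff[OF hk q q] comp_eq_iff[OF hk r r]
        comp_eq_iff[OF id q q] comp_eq_iff[OF id r r] fn_Comp[OF k(1) h(1)])
  then have "h \<cdot>\<^bsub>D\<^esub> k = Idn D W"
    using univ[OF q r qr] hk id by blast
  then have hkw: "fn h (fn k w) = w" if "w \<in> car W" for w
    using that W fn_Comp[OF k(1) h(1) that] by simp
  show ?thesis
  proof (rule tabulatesI[OF q r qr])
    fix w w' assume w: "w \<in> car W" "w' \<in> car W" and e: "fn q w = fn q w'" "fn r w = fn r w'"
    have "fn k w = fn k w'"
      using e qk rk w by - (rule tabulates_inj[OF T], simp_all add: homD(6)[OF k(1)])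
    then have "fn h (fn k w) = fn h (fn k w')"
      by (rule arg_cong)
    then show "w = w'"
      by (simp only: hkw w)
  next
    fix x y assume "(x, y) \<in> R"
    then obtain w where "w \<in> car W'" "fn q' w = x" "fn r' w = y"
      by (rule tabulates_surj[OF T])
    then show "\<exists>w\<in>car W. fn q w = x \<and> fn r w = y"
      using qh rh homD(6)[OF h(1)] by (intro bexI[of _ "fn h w"]) auto
  qed
qed



section \<open>Pullbacks, monomorphisms and products\<close>

lemma pullback_tabulates:
  assumes f: "f \<in> hom D U Y" and g: "g \<in> hom D V Y" and pb: "is_pullback D f g q r"
  shows "tabulates U V {(u, v). u \<in> car U \<and> v \<in> car V \<and> fn f u = fn g v} (src q) q r"
proof (rule universal_tabulates)
  have q: "q \<in> hom D (src q) U" and r: "r \<in> hom D (src q) V"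
    and e: "f \<cdot>\<^bsub>D\<^esub> q = g \<cdot>\<^bsub>D\<^esub> r"
    using pb homD(4)[OF f] homD(4)[OF g] by (auto simp: is_pullback_def hom_def)
  then show "q \<in> hom D (src q) U" "r \<in> hom D (src q) V"
    by blast+
  show "invariant U V {(u, v). u \<in> car U \<and> v \<in> car V \<and> fn f u = fn g v}"
    using homD(1,7)[OF f] homD(1,7)[OF g] by (auto simp: invariant_def)
  show "(fn q w, fn r w) \<in> {(u, v). u \<in> car U \<and> v \<in> car V \<and> fn f u = fn g v}"
    if "w \<in> car (src q)" for w
    using e that homD(6)[OF q] homD(6)[OF r] by (simp add: comp_eq_comp_iff[OF q f r g])
  fix W s t
  assume s: "s \<in> hom D W U" and t: "t \<in> hom D W V"
    and st: "\<And>w. w \<in> car W \<Longrightarrow> (fn s w, fn t w) \<in>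
      {(u, v). u \<in> car U \<and> v \<in> car V \<and> fn f u = fn g v}"
  have "f \<cdot>\<^bsub>D\<^esub> s = g \<cdot>\<^bsub>D\<^esub> t"
    using st by (simp add: comp_eq_comp_iff[OF s f t g])
  then show "\<exists>!h. h \<in> hom D W (src q) \<and> q \<cdot>\<^bsub>D\<^esub> h = s \<and> r \<cdot>\<^bsub>D\<^esub> h = t"
    using pb s t homD(4)[OF f] homD(4)[OF g] homD(1)[OF s]
    unfolding is_pullback_def Dom_D by blast
qed

lemma pullback_exists:
  assumes f: "f \<in> hom D U Y" and g: "g \<in> hom D V Y"
  obtains q r where "is_pullback D f g q r"
proof -
  let ?R = "{(u, v). u \<in> car U \<and> v \<in> car V \<and> fn f u = fn g v}"
  have R: "invariant U V ?R"
    using homD(1,7)[OF f] homD(1,7)[OF g] by (auto simp: invariant_def)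
  obtain W q r where T: "tabulates U V ?R W q r"
    using tabulation_exists[OF homD(1)[OF f] homD(1)[OF g] R] .
  then have q: "q \<in> hom D W U" and r: "r \<in> hom D W V"
    by (auto simp: tabulates_def)
  have e: "f \<cdot>\<^bsub>D\<^esub> q = g \<cdot>\<^bsub>D\<^esub> r"
    using tabulates_image[OF T] by (simp add: comp_eq_comp_iff[OF q f r g])
  have u: "\<exists>!h. h \<in> hom D V' W \<and> q \<cdot>\<^bsub>D\<^esub> h = s \<and> r \<cdot>\<^bsub>D\<^esub> h = t"
    if s: "s \<in> hom D V' U" and t: "t \<in> hom D V' V" and st: "f \<cdot>\<^bsub>D\<^esub> s = g \<cdot>\<^bsub>D\<^esub> t" for V' s t
    using st homD(6)[OF s] homD(6)[OF t]
    by (intro tabulates_universal[OF T s t]) (simp add: comp_eq_comp_iff[OF s f t g])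
  have "is_pullback D f g q r"
    using u e homD(3-5)[OF f] homD(3-5)[OF g] homD(3-5)[OF q] homD(3-5)[OF r]
    by (simp add: is_pullback_def)
  then show ?thesis
    by (rule that)
qed

text \<open>The kernel pair of \<open>m\<close> has a point for every pair of elements that \<open>m\<close> identifies, and its
  two projections agree when \<open>m\<close> is a monomorphism.\<close>
lemma mono_inj:
  assumes m: "m \<in> hom D U X" and mono: "mono_ar D m"
  shows "inj_on (fn m) (car U)"
proof -
  obtain q r where pb: "is_pullback D m m q r"
    using pullback_exists[OF m m] .
  note T = pullback_tabulates[OF m m pb]
  have q: "q \<in> hom D (src q) U" and r: "r \<in> hom D (src q) U"
    using T by (auto simp: tabulates_def)
  have "m \<cdot>\<^bsub>D\<^esub> q = m \<cdot>\<^bsub>D\<^esub> r"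
    using pb by (simp add: is_pullback_def)
  then have qr: "q = r"
    using mono q r homD(1)[OF q] homD(4)[OF m] by (simp add: mono_ar_def)
  show ?thesis
  proof (rule inj_onI)
    fix u v assume "u \<in> car U" "v \<in> car U" "fn m u = fn m v"
    then obtain w where "fn q w = u" "fn r w = v"
      by (auto intro: tabulates_surj[OF T, of u v])
    with qr show "u = v"
      by simp
  qed
qed

lemma inj_mono:
  assumes m: "m \<in> hom D U X" and inj: "inj_on (fn m) (car U)"
  shows "mono_ar D m"
proof -
  have "f = g" if f: "f \<in> hom D W U" and g: "g \<in> hom D W U" and e: "m \<cdot>\<^bsub>D\<^esub> f = m \<cdot>\<^bsub>D\<^esub> g" for W f g
    using e inj homD(6)[OF f] homD(6)[OF g]
    by (intro hom_eqI[OF f g]) (auto simp: comp_eq_comp_iff[OF f m g m] inj_on_def)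
  then show ?thesis
    using homD(3,4)[OF m] by (auto simp: mono_ar_def)
qed

lemma prod_tabulates:
  assumes X: "X \<in> Ob D" and Y: "Y \<in> Ob D"
  shows "tabulates X Y (car X \<times> car Y) (prod_ob D X Y) (prod_p0 D X Y) (prod_p1 D X Y)"
proof -
  have R: "invariant X Y (car X \<times> car Y)"
    using X Y by (auto simp: invariant_def)
  obtain W q r where T: "tabulates X Y (car X \<times> car Y) W q r"
    using tabulation_exists[OF X Y R] .
  then have q: "q \<in> hom D W X" and r: "r \<in> hom D W Y"
    by (auto simp: tabulates_def)
  have "\<exists>!h. h \<in> hom D V W \<and> q \<cdot>\<^bsub>D\<^esub> h = s \<and> r \<cdot>\<^bsub>D\<^esub> h = t"
    if s: "s \<in> hom D V X" and t: "t \<in> hom D V Y" for V s t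
    using homD(6)[OF s] homD(6)[OF t] by (intro tabulates_universal[OF T s t]) simp
  then have "is_product D X Y (W, q, r)"
    using q r homD(1)[OF q] by (simp add: is_product_def)
  then have "is_product D X Y (prod_cone D X Y)"
    unfolding prod_cone_def by (rule someI)
  then have "is_product D X Y (prod_ob D X Y, prod_p0 D X Y, prod_p1 D X Y)"
    by (simp add: prod_ob_def prod_p0_def prod_p1_def)
  then have p: "prod_p0 D X Y \<in> hom D (prod_ob D X Y) X" "prod_p1 D X Y \<in> hom D (prod_ob D X Y) Y"
    and u: "\<And>V s t. \<lbrakk>V \<in> Ob D; s \<in> hom D V X; t \<in> hom D V Y\<rbrakk> \<Longrightarrow>
      \<exists>!h. h \<in> hom D V (prod_ob D X Y) \<and> prod_p0 D X Y \<cdot>\<^bsub>D\<^esub> h = s \<and> prod_p1 D X Y \<cdot>\<^bsub>D\<^esub> h = t"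
    by (auto simp: is_product_def)
  show ?thesis
    using homD(6)[OF p(1)] homD(6)[OF p(2)]
    by (intro universal_tabulates[OF R p] u) (auto intro: homD(1))
qed


section \<open>Morphisms of partial maps as relations\<close>

definition pmor :: "'u dyn \<Rightarrow> 'u dyn \<Rightarrow> ('u \<times> 'u) set \<Rightarrow> bool" where
  "pmor X Y R \<longleftrightarrow> X \<in> Ob D \<and> Y \<in> Ob D \<and> invariant X Y R \<and> single_valued R"

definition cls :: "'u dyn \<Rightarrow> 'u dyn \<Rightarrow> ('u \<times> 'u) set \<Rightarrow> ('u dynar \<times> 'u dynar) set" where
  "cls X Y R = {(m, \<phi>). tabulates X Y R (src m) m \<phi>}"

lemma clsI: "tabulates X Y R W m \<phi> \<Longrightarrow> (m, \<phi>) \<in> cls X Y R"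
  using homD(4)[of m W X] by (simp add: cls_def tabulates_def)

lemma cls_nonempty:
  assumes "pmor X Y R"
  obtains m \<phi> W where "(m, \<phi>) \<in> cls X Y R" "tabulates X Y R W m \<phi>"
proof -
  obtain W m \<phi> where "tabulates X Y R W m \<phi>"
    using assms unfolding pmor_def by (blast intro: tabulation_exists)
  then show ?thesis
    by (intro that[OF clsI])
qed

text \<open>Single-valuedness of \<open>R\<close> is what makes the first leg of a tabulation injective.\<close>
lemma tabulates_pspan:
  assumes "pmor X Y R" and T: "tabulates X Y R W m \<phi>"
  shows "(m, \<phi>) \<in> pspans D"
proof -
  have m: "m \<in> hom D W X" and \<phi>: "\<phi> \<in> hom D W Y"
    using T by (auto simp: tabulates_def)
  have "inj_on (fn m) (car W)"
  proof (rule inj_onI)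
    fix u v assume uv: "u \<in> car W" "v \<in> car W" "fn m u = fn m v"
    then have "fn \<phi> u = fn \<phi> v"
      using tabulates_image[OF T uv(1)] tabulates_image[OF T uv(2)] assms(1)
      by (auto simp: pmor_def dest: single_valuedD)
    then show "u = v"
      by (rule tabulates_inj[OF T uv])
  qed
  then show ?thesis
    using inj_mono[OF m] homD[OF m] homD[OF \<phi>] by (simp add: pspans_def)
qed

lemma pspan_tabulates:
  assumes "(m, \<phi>) \<in> pspans D"
  obtains R where "pmor (tgt m) (tgt \<phi>) R" "tabulates (tgt m) (tgt \<phi>) R (src m) m \<phi>"
proof -
  have m: "m \<in> hom D (src m) (tgt m)" and \<phi>: "\<phi> \<in> hom D (src m) (tgt \<phi>)" and mono: "mono_ar D m"
    using assms Ar_hom[of m] Ar_hom[of \<phi>] by (auto simp: pspans_def mono_ar_def)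
  define R where "R = (\<lambda>u. (fn m u, fn \<phi> u)) ` car (src m)"
  have inj: "inj_on (fn m) (car (src m))"
    using mono_inj[OF m mono] .
  have 1: "tabulates (tgt m) (tgt \<phi>) R (src m) m \<phi>"
    using m \<phi> inj by (auto simp: tabulates_def bij_betw_def R_def inj_on_def)
  have sv: "single_valued R"
    using inj by (auto simp: single_valued_def R_def inj_on_def)
  have "invariant (tgt m) (tgt \<phi>) R"
    unfolding invariant_def
  proof safe
    fix x y assume "(x, y) \<in> R"
    then obtain u where u: "u \<in> car (src m)" "x = fn m u" "y = fn \<phi> u"
      by (auto simp: R_def)
    show "x \<in> car (tgt m)" "y \<in> car (tgt \<phi>)"
      using u homD(6)[OF m] homD(6)[OF \<phi>] by auto
    have "act (tgt m) x = fn m (act (src m) u)" "act (tgt \<phi>) y = fn \<phi> (act (src m) u)"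
      using u homD(7)[OF m] homD(7)[OF \<phi>] by simp_all
    then show "(act (tgt m) x, act (tgt \<phi>) y) \<in> R"
      using act_closed[OF homD(1)[OF m] u(1)] by (auto simp: R_def)
  qed
  then show ?thesis
    using that 1 sv homD(2)[OF m] homD(2)[OF \<phi>] by (simp add: pmor_def)
qed

text \<open>Two spans are equivalent precisely if they tabulate the same relation: tabulations of the
  same relation are isomorphic by their universal property, and an isomorphism of spans leaves the set
  of pairs of values unchanged.\<close>
lemma pclass_eq_cls:
  assumes P: "pmor X Y R" and T: "tabulates X Y R W m \<phi>"
  shows "pclass D m \<phi> = cls X Y R"
proof
  have m: "m \<in> hom D W X" and \<phi>: "\<phi> \<in> hom D W Y"
    using T by (auto simp: tabulates_def)
  show "pclass D m \<phi> \<subseteq> cls X Y R"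
  proof
    fix c assume "c \<in> pclass D m \<phi>"
    then obtain m' \<phi>' \<theta> where c: "c = (m', \<phi>')" "(m', \<phi>') \<in> pspans D"
      and \<theta>: "\<theta> \<in> hom D W (src m')" "iso_ar D \<theta>"
      and e: "m = m' \<cdot>\<^bsub>D\<^esub> \<theta>" "\<phi> = \<phi>' \<cdot>\<^bsub>D\<^esub> \<theta>"
      using homD(4)[OF m] by (auto simp: pclass_def pspan_rel_def)
    obtain R' where T': "tabulates (tgt m') (tgt \<phi>') R' (src m') m' \<phi>'"
      using pspan_tabulates[OF c(2)] by blast
    then have "m' \<in> hom D (src m') (tgt m')" "\<phi>' \<in> hom D (src m') (tgt \<phi>')"
      by (auto simp: tabulates_def)
    moreover from this have "tgt m' = X" "tgt \<phi>' = Y"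
      using homD(5)[OF m] homD(5)[OF \<phi>] homD(5)[OF Comp_hom[OF \<theta>(1)]] e by metis+
    ultimately have m': "m' \<in> hom D (src m') X" and \<phi>': "\<phi>' \<in> hom D (src m') Y"
      by simp_all
    obtain \<kappa> where \<kappa>: "\<kappa> \<in> hom D (src m') W" "\<theta> \<cdot>\<^bsub>D\<^esub> \<kappa> = Idn D (src m')"
      using \<theta>(2) homD(4,5)[OF \<theta>(1)] by (auto simp: iso_ar_def)
    have e': "fn m w = fn m' (fn \<theta> w)" "fn \<phi> w = fn \<phi>' (fn \<theta> w)" if "w \<in> car W" for w
      using that e m' \<phi>' \<theta>(1) by simp_all
    have \<theta>\<kappa>: "fn \<theta> (fn \<kappa> w) = w" if "w \<in> car (src m')" for w
      using that fn_Comp[OF \<kappa>(1) \<theta>(1) that] homD(1)[OF \<kappa>(1)] \<kappa>(2) by simp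
    have "tabulates X Y R (src m') m' \<phi>'"
    proof (rule tabulatesI[OF m' \<phi>'])
      fix w assume w: "w \<in> car (src m')"
      have kw: "fn \<kappa> w \<in> car W"
        using homD(6)[OF \<kappa>(1) w] .
      show "(fn m' w, fn \<phi>' w) \<in> R"
        using tabulates_image[OF T kw] by (simp add: e'[OF kw] \<theta>\<kappa>[OF w])
    next
      fix w w' assume "w \<in> car (src m')" "w' \<in> car (src m')" "fn m' w = fn m' w'" "fn \<phi>' w = fn \<phi>' w'"
      then show "w = w'"
        by (rule tabulates_inj[OF T'])
    next
      fix x y assume "(x, y) \<in> R"
      then obtain w where w: "w \<in> car W" "fn m w = x" "fn \<phi> w = y"
        by (rule tabulates_surj[OF T])
      then show "\<exists>w\<in>car (src m'). fn m' w = x \<and> fn \<phi>' w = y"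
        using homD(6)[OF \<theta>(1) w(1)] by (intro bexI[of _ "fn \<theta> w"]) (auto simp: e')
    qed
    then show "c \<in> cls X Y R"
      unfolding c(1) by (rule clsI)
  qed
  show "cls X Y R \<subseteq> pclass D m \<phi>"
  proof
    fix c assume "c \<in> cls X Y R"
    then obtain m' \<phi>' W' where c: "c = (m', \<phi>')" and T': "tabulates X Y R W' m' \<phi>'"
      unfolding cls_def by blast
    then have m': "m' \<in> hom D W' X" and \<phi>': "\<phi>' \<in> hom D W' Y"
      by (auto simp: tabulates_def)
    obtain \<theta> where \<theta>: "\<theta> \<in> hom D W W'" "m' \<cdot>\<^bsub>D\<^esub> \<theta> = m" "\<phi>' \<cdot>\<^bsub>D\<^esub> \<theta> = \<phi>"
      using tabulates_universal[OF T' m \<phi> tabulates_image[OF T]] by blast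
    obtain \<kappa> where \<kappa>: "\<kappa> \<in> hom D W' W" "m \<cdot>\<^bsub>D\<^esub> \<kappa> = m'" "\<phi> \<cdot>\<^bsub>D\<^esub> \<kappa> = \<phi>'"
      using tabulates_universal[OF T m' \<phi>' tabulates_image[OF T']] by blast
    have a: "fn m' (fn \<theta> w) = fn m w" "fn \<phi>' (fn \<theta> w) = fn \<phi> w" if "w \<in> car W" for w
      using that fn_Comp[OF \<theta>(1) m' that] fn_Comp[OF \<theta>(1) \<phi>' that] \<theta> by simp_all
    have b: "fn m (fn \<kappa> w) = fn m' w" "fn \<phi> (fn \<kappa> w) = fn \<phi>' w" if "w \<in> car W'" for w
      using that fn_Comp[OF \<kappa>(1) m that] fn_Comp[OF \<kappa>(1) \<phi> that] \<kappa> by simp_all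
    have W: "W \<in> Ob D" "W' \<in> Ob D"
      using homD(1)[OF m] homD(1)[OF m'] .
    have "\<kappa> \<cdot>\<^bsub>D\<^esub> \<theta> = Idn D W"
    proof (rule hom_eqI[OF Comp_hom[OF \<theta>(1) \<kappa>(1)] Idn_hom[OF W(1)]])
      fix w assume w: "w \<in> car W"
      note tw = homD(6)[OF \<theta>(1) w]
      have "fn \<kappa> (fn \<theta> w) = w"
        by (rule tabulates_inj[OF T homD(6)[OF \<kappa>(1) tw] w]) (simp_all add: a b tw w)
      then show "fn (\<kappa> \<cdot>\<^bsub>D\<^esub> \<theta>) w = fn (Idn D W) w"
        using w W by (simp add: fn_Comp[OF \<theta>(1) \<kappa>(1)])
    qed
    moreover have "\<theta> \<cdot>\<^bsub>D\<^esub> \<kappa> = Idn D W'"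
    proof (rule hom_eqI[OF Comp_hom[OF \<kappa>(1) \<theta>(1)] Idn_hom[OF W(2)]])
      fix w assume w: "w \<in> car W'"
      note tw = homD(6)[OF \<kappa>(1) w]
      have "fn \<theta> (fn \<kappa> w) = w"
        by (rule tabulates_inj[OF T' homD(6)[OF \<theta>(1) tw] w]) (simp_all add: a b tw w)
      then show "fn (\<theta> \<cdot>\<^bsub>D\<^esub> \<kappa>) w = fn (Idn D W') w"
        using w W by (simp add: fn_Comp[OF \<kappa>(1) \<theta>(1)])
    qed
    ultimately have "iso_ar D \<theta>"
      using homD(3-5)[OF \<theta>(1)] \<kappa>(1) by (auto simp: iso_ar_def)
    then show "c \<in> pclass D m \<phi>"
      using tabulates_pspan[OF P T] tabulates_pspan[OF P T'] \<theta> homD(4)[OF m] homD(4)[OF m'] c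
      by (auto simp: pclass_def pspan_rel_def)
  qed
qed

abbreviation \<P> :: "('u dyn, ('u dynar \<times> 'u dynar) set) pcat" where
  "\<P> \<equiv> Pfn D"

lemma Ob_P [simp]: "Ob \<P> = Ob D"
  by (simp add: Pfn_def)

lemma Ar_P: "c \<in> Ar \<P> \<longleftrightarrow> (\<exists>X Y R. pmor X Y R \<and> c = cls X Y R)"
proof -
  have "c \<in> Ar \<P> \<longleftrightarrow> (\<exists>m \<phi>. (m, \<phi>) \<in> pspans D \<and> c = pclass D m \<phi>)"
    by (auto simp: Pfn_def quotient_def pclass_def)
  also have "\<dots> \<longleftrightarrow> (\<exists>X Y R. pmor X Y R \<and> c = cls X Y R)"
  proof safe
    fix m \<phi> assume "(m, \<phi>) \<in> pspans D"
    then obtain R where "pmor (tgt m) (tgt \<phi>) R" "tabulates (tgt m) (tgt \<phi>) R (src m) m \<phi>"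
      by (rule pspan_tabulates)
    then show "\<exists>X Y R. pmor X Y R \<and> pclass D m \<phi> = cls X Y R"
      using pclass_eq_cls by blast
  next
    fix X Y R assume P: "pmor X Y R"
    obtain m \<phi> W where "tabulates X Y R W m \<phi>"
      using cls_nonempty[OF P] .
    then show "\<exists>m \<phi>. (m, \<phi>) \<in> pspans D \<and> cls X Y R = pclass D m \<phi>"
      using tabulates_pspan[OF P] pclass_eq_cls[OF P] by blast
  qed
  finally show ?thesis .
qed

lemma Dom_P [simp]: "pmor X Y R \<Longrightarrow> Dom \<P> (cls X Y R) = X"
  and Cod_P [simp]: "pmor X Y R \<Longrightarrow> Cod \<P> (cls X Y R) = Y"
proof -
  assume P: "pmor X Y R"
  have *: "tgt m = X" "tgt \<phi> = Y" if "(m, \<phi>) \<in> cls X Y R" for m \<phi>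
    using that by (auto simp: cls_def tabulates_def dest: homD(5))
  obtain m \<phi> W where "(m, \<phi>) \<in> cls X Y R" "tabulates X Y R W m \<phi>"
    using cls_nonempty[OF P] .
  then have "(\<lambda>(m, \<phi>). tgt m) ` cls X Y R = {X}" "(\<lambda>(m, \<phi>). tgt \<phi>) ` cls X Y R = {Y}"
    using * by (auto simp: image_iff intro!: bexI[of _ "(m, \<phi>)"])
  then show "Dom \<P> (cls X Y R) = X" "Cod \<P> (cls X Y R) = Y"
    by (simp_all add: Pfn_def)
qed

lemma hom_P: "c \<in> hom \<P> X Y \<longleftrightarrow> (\<exists>R. pmor X Y R \<and> c = cls X Y R)"
proof
  assume c: "c \<in> hom \<P> X Y"
  then obtain X' Y' R where "pmor X' Y' R" "c = cls X' Y' R"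
    unfolding hom_def by (metis (lifting) Ar_P mem_Collect_eq)
  with c have "pmor X Y R \<and> c = cls X Y R"
    by (simp add: hom_def)
  then show "\<exists>R. pmor X Y R \<and> c = cls X Y R"
    by (rule exI)
next
  assume "\<exists>R. pmor X Y R \<and> c = cls X Y R"
  then obtain R where R: "pmor X Y R" "c = cls X Y R"
    by blast
  then have "c \<in> Ar \<P>"
    unfolding Ar_P by blast
  with R show "c \<in> hom \<P> X Y"
    by (simp add: hom_def)
qed

lemma cls_eq_iff: 
  assumes P: "pmor X Y R"  
  shows "cls X Y R = cls X Y S \<longleftrightarrow> R = S"
proof
  assume e: "cls X Y R = cls X Y S"
  obtain m \<phi> W where c: "(m, \<phi>) \<in> cls X Y R" and T: "tabulates X Y R W m \<phi>"
    using cls_nonempty[OF P] .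
  have "tabulates X Y R (src m) m \<phi>" "tabulates X Y S (src m) m \<phi>"
    using c c[unfolded e] by (simp_all add: cls_def)
  then show "R = S"
    by (simp add: tabulates_def bij_betw_def)
qed simp

lemma pmor_Id: "X \<in> Ob D \<Longrightarrow> pmor X X (Id_on (car X))"
  by (auto simp: pmor_def invariant_def single_valued_def)

lemma Idn_P: 
  assumes X: "X \<in> Ob D"
  shows "Idn \<P> X = cls X X (Id_on (car X))"
proof -
  have "tabulates X X (Id_on (car X)) X (Idn D X) (Idn D X)"
    using X by (auto intro!: tabulatesI)
  then show ?thesis
    by (simp add: Pfn_def pclass_eq_cls[OF pmor_Id[OF X]])
qed

lemma pmor_comp: "\<lbrakk>pmor X Y R; pmor Y Z S\<rbrakk> \<Longrightarrow> pmor X Z (R O S)"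
  unfolding pmor_def invariant_def by (auto intro: single_valued_relcomp)

text \<open>The value of the composite span at a point of the pullback is a pair \<open>(m u, \<psi> v)\<close> with
  \<open>\<phi> u = n v\<close>. These pairs form \<open>R O S\<close>, and each of them determines \<open>u\<close> and \<open>v\<close>: \<open>m u\<close> determines
  \<open>\<phi> u = n v\<close> because \<open>R\<close> is single-valued.\<close>
lemma Comp_P:
  assumes R: "pmor X Y R" and S: "pmor Y Z S"
  shows "cls Y Z S \<cdot>\<^bsub>\<P>\<^esub> cls X Y R = cls X Z (R O S)"
proof -
  have *: "pclass D (m \<cdot>\<^bsub>D\<^esub> q) (\<psi> \<cdot>\<^bsub>D\<^esub> r) = cls X Z (R O S)"
    if m: "(m, \<phi>) \<in> cls X Y R" and n: "(n, \<psi>) \<in> cls Y Z S" and pb: "is_pullback D \<phi> n q r"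
    for m \<phi> n \<psi> q r
  proof (rule pclass_eq_cls[OF pmor_comp[OF R S]])
    obtain U where TU: "tabulates X Y R U m \<phi>"
      using m unfolding cls_def by blast
    obtain V where TV: "tabulates Y Z S V n \<psi>"
      using n unfolding cls_def by blast
    have m: "m \<in> hom D U X" and \<phi>: "\<phi> \<in> hom D U Y" and n: "n \<in> hom D V Y" and \<psi>: "\<psi> \<in> hom D V Z"
      using TU TV by (auto simp: tabulates_def)
    note T = pullback_tabulates[OF \<phi> n pb]
    define W where "W = src q"
    have q: "q \<in> hom D W U" and r: "r \<in> hom D W V"
      using T by (auto simp: tabulates_def W_def)
    have qr: "fn \<phi> (fn q w) = fn n (fn r w)" "fn q w \<in> car U" "fn r w \<in> car V" if "w \<in> car W" for w
      using tabulates_image[OF T] that by (auto simp: W_def)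
    show "tabulates X Z (R O S) (src q) (m \<cdot>\<^bsub>D\<^esub> q) (\<psi> \<cdot>\<^bsub>D\<^esub> r)"
      unfolding W_def[symmetric]
    proof (rule tabulatesI[OF Comp_hom[OF q m] Comp_hom[OF r \<psi>]])
      fix w assume w: "w \<in> car W"
      show "(fn (m \<cdot>\<^bsub>D\<^esub> q) w, fn (\<psi> \<cdot>\<^bsub>D\<^esub> r) w) \<in> R O S"
        using tabulates_image[OF TU qr(2)[OF w]] tabulates_image[OF TV qr(3)[OF w]] qr(1)[OF w]
        by (auto simp: fn_Comp[OF q m w] fn_Comp[OF r \<psi> w])
    next
      fix w w' assume w: "w \<in> car W" and w': "w' \<in> car W"
        and e: "fn (m \<cdot>\<^bsub>D\<^esub> q) w = fn (m \<cdot>\<^bsub>D\<^esub> q) w'" "fn (\<psi> \<cdot>\<^bsub>D\<^esub> r) w = fn (\<psi> \<cdot>\<^bsub>D\<^esub> r) w'"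
      have em: "fn m (fn q w) = fn m (fn q w')" and e\<psi>: "fn \<psi> (fn r w) = fn \<psi> (fn r w')"
        using e by (simp_all only: fn_Comp[OF q m w] fn_Comp[OF r \<psi> w] fn_Comp[OF q m w'] fn_Comp[OF r \<psi> w'])
      have e\<phi>: "fn \<phi> (fn q w) = fn \<phi> (fn q w')"
        using tabulates_image[OF TU qr(2)[OF w]] tabulates_image[OF TU qr(2)[OF w']] R em
        by (auto simp: pmor_def dest: single_valuedD)
      have "fn q w = fn q w'"
        by (rule tabulates_inj[OF TU qr(2)[OF w] qr(2)[OF w'] em e\<phi>])
      moreover have "fn r w = fn r w'"
        using e\<phi> e\<psi> qr(1)[OF w] qr(1)[OF w']
        by (intro tabulates_inj[OF TV qr(3)[OF w] qr(3)[OF w']]) simp_all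
      ultimately show "w = w'"
        using w w' unfolding W_def by - (rule tabulates_inj[OF T])
    next
      fix x z assume "(x, z) \<in> R O S"
      then obtain y where y: "(x, y) \<in> R" "(y, z) \<in> S"
        by blast
      obtain u where u: "u \<in> car U" "fn m u = x" "fn \<phi> u = y"
        using tabulates_surj[OF TU y(1)] .
      obtain v where v: "v \<in> car V" "fn n v = y" "fn \<psi> v = z"
        using tabulates_surj[OF TV y(2)] .
      have "(u, v) \<in> {(u, v). u \<in> car U \<and> v \<in> car V \<and> fn \<phi> u = fn n v}"
        using u v by simp
      then obtain w where "w \<in> car W" "fn q w = u" "fn r w = v"
        unfolding W_def by (rule tabulates_surj[OF T])
      then show "\<exists>w\<in>car W. fn (m \<cdot>\<^bsub>D\<^esub> q) w = x \<and> fn (\<psi> \<cdot>\<^bsub>D\<^esub> r) w = z"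
        using u v by (intro bexI[of _ w]) (simp_all add: fn_Comp[OF q m] fn_Comp[OF r \<psi>])
    qed
  qed
  obtain m \<phi> U where m: "(m, \<phi>) \<in> cls X Y R" "tabulates X Y R U m \<phi>"
    using cls_nonempty[OF R] .
  obtain n \<psi> V where n: "(n, \<psi>) \<in> cls Y Z S" "tabulates Y Z S V n \<psi>"
    using cls_nonempty[OF S] .
  obtain q r where "is_pullback D \<phi> n q r"
    using pullback_exists[of \<phi> U Y n V] m n by (auto simp: tabulates_def)
  then have "{pclass D (m \<cdot>\<^bsub>D\<^esub> q) (\<psi> \<cdot>\<^bsub>D\<^esub> r) | m \<phi> n \<psi> q r.
      (m, \<phi>) \<in> cls X Y R \<and> (n, \<psi>) \<in> cls Y Z S \<and> is_pullback D \<phi> n q r} = {cls X Z (R O S)}"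
    using m n * by blast
  then show ?thesis
    by (simp add: Pfn_def)
qed



section \<open>Near products of partial maps\<close>

definition pr0 :: "'u dyn \<Rightarrow> 'u dyn \<Rightarrow> 'u \<Rightarrow> 'u" where
  "pr0 X Y = fn (prod_p0 D X Y)"

definition pr1 :: "'u dyn \<Rightarrow> 'u dyn \<Rightarrow> 'u \<Rightarrow> 'u" where
  "pr1 X Y = fn (prod_p1 D X Y)"

text \<open>The point of the product with given coordinates. The product cone is an arbitrary one, so
  its points need not be pairs.\<close>
definition mkp :: "'u dyn \<Rightarrow> 'u dyn \<Rightarrow> 'u \<Rightarrow> 'u \<Rightarrow> 'u" where
  "mkp X Y x y = (SOME p. p \<in> car (prod_ob D X Y) \<and> pr0 X Y p = x \<and> pr1 X Y p = y)"

lemma proj_hom: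
  assumes "X \<in> Ob D" "Y \<in> Ob D"
  shows "prod_p0 D X Y \<in> hom D (prod_ob D X Y) X" "prod_p1 D X Y \<in> hom D (prod_ob D X Y) Y"
  using prod_tabulates[OF assms] by (simp_all add: tabulates_def)

lemma prod_Ob [simp, intro]: "\<lbrakk>X \<in> Ob D; Y \<in> Ob D\<rbrakk> \<Longrightarrow> prod_ob D X Y \<in> Ob D"
  by (rule homD(1)[OF proj_hom(1)])

lemma pr_car [simp]:
  assumes "X \<in> Ob D" "Y \<in> Ob D" "p \<in> car (prod_ob D X Y)"
  shows "pr0 X Y p \<in> car X" "pr1 X Y p \<in> car Y"
  using homD(6)[OF proj_hom(1)[OF assms(1,2)] assms(3)] homD(6)[OF proj_hom(2)[OF assms(1,2)] assms(3)]
  by (simp_all add: pr0_def pr1_def)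

lemma pr_act [simp]:
  assumes "X \<in> Ob D" "Y \<in> Ob D" "p \<in> car (prod_ob D X Y)"
  shows "pr0 X Y (act (prod_ob D X Y) p) = act X (pr0 X Y p)"
    "pr1 X Y (act (prod_ob D X Y) p) = act Y (pr1 X Y p)"
  using homD(7)[OF proj_hom(1)[OF assms(1,2)] assms(3)] homD(7)[OF proj_hom(2)[OF assms(1,2)] assms(3)]
  by (simp_all add: pr0_def pr1_def)

lemma pr_eqI:
  assumes "X \<in> Ob D" "Y \<in> Ob D" "p \<in> car (prod_ob D X Y)" "q \<in> car (prod_ob D X Y)"
    "pr0 X Y p = pr0 X Y q" "pr1 X Y p = pr1 X Y q"
  shows "p = q"
  using assms(3-) by - (rule tabulates_inj[OF prod_tabulates[OF assms(1,2)] assms(3,4)], simp_all add: pr0_def pr1_def)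

lemma mkp [simp]:
  assumes "X \<in> Ob D" "Y \<in> Ob D" "x \<in> car X" "y \<in> car Y"
  shows "mkp X Y x y \<in> car (prod_ob D X Y)" "pr0 X Y (mkp X Y x y) = x" "pr1 X Y (mkp X Y x y) = y"
proof -
  have "(x, y) \<in> car X \<times> car Y"
    using assms by simp
  then obtain p where "p \<in> car (prod_ob D X Y)" "pr0 X Y p = x" "pr1 X Y p = y"
    unfolding pr0_def pr1_def by (rule tabulates_surj[OF prod_tabulates[OF assms(1,2)]])
  then have "p \<in> car (prod_ob D X Y) \<and> pr0 X Y p = x \<and> pr1 X Y p = y"
    by blast
  from someI[of "\<lambda>p. p \<in> car (prod_ob D X Y) \<and> pr0 X Y p = x \<and> pr1 X Y p = y", OF this]
  show "mkp X Y x y \<in> car (prod_ob D X Y)" "pr0 X Y (mkp X Y x y) = x" "pr1 X Y (mkp X Y x y) = y"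
    by (simp_all add: mkp_def)
qed

lemma mkp_pr [simp]:
  assumes "X \<in> Ob D" "Y \<in> Ob D" "p \<in> car (prod_ob D X Y)"
  shows "mkp X Y (pr0 X Y p) (pr1 X Y p) = p"
  using assms by - (rule pr_eqI[OF assms(1,2)], simp_all)

lemma act_mkp [simp]:
  assumes "X \<in> Ob D" "Y \<in> Ob D" "x \<in> car X" "y \<in> car Y"
  shows "act (prod_ob D X Y) (mkp X Y x y) = mkp X Y (act X x) (act Y y)"
  using assms by - (rule pr_eqI[OF assms(1,2)], simp_all)

definition boxR ::
  "'u dyn \<Rightarrow> 'u dyn \<Rightarrow> 'u dyn \<Rightarrow> 'u dyn \<Rightarrow> ('u \<times> 'u) set \<Rightarrow> ('u \<times> 'u) set \<Rightarrow> ('u \<times> 'u) set" where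
  "boxR X Y X' Y' R S = {(p, q). p \<in> car (prod_ob D X X') \<and> q \<in> car (prod_ob D Y Y') \<and>
     (pr0 X X' p, pr0 Y Y' q) \<in> R \<and> (pr1 X X' p, pr1 Y Y' q) \<in> S}"

lemma pmorD:
  assumes "pmor X Y R"
  shows "X \<in> Ob D" "Y \<in> Ob D" "(x, y) \<in> R \<Longrightarrow> x \<in> car X" "(x, y) \<in> R \<Longrightarrow> y \<in> car Y"
    "(x, y) \<in> R \<Longrightarrow> (act X x, act Y y) \<in> R" "\<lbrakk>(x, y) \<in> R; (x, z) \<in> R\<rbrakk> \<Longrightarrow> y = z"
  using assms by (auto simp: pmor_def invariant_def dest: single_valuedD)

lemma pmorI:
  assumes "X \<in> Ob D" "Y \<in> Ob D"
    "\<And>x y. (x, y) \<in> R \<Longrightarrow> x \<in> car X \<and> y \<in> car Y \<and> (act X x, act Y y) \<in> R"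
    "\<And>x y z. \<lbrakk>(x, y) \<in> R; (x, z) \<in> R\<rbrakk> \<Longrightarrow> y = z"
  shows "pmor X Y R"
proof -
  have "invariant X Y R"
    using assms(3) by (auto simp: invariant_def)
  moreover have "single_valued R"
    using assms(4) by (rule single_valuedI)
  ultimately show ?thesis
    using assms(1,2) by (simp add: pmor_def)
qed

lemma pmor_box:
  assumes R: "pmor X Y R" and S: "pmor X' Y' S"
  shows "pmor (prod_ob D X X') (prod_ob D Y Y') (boxR X Y X' Y' R S)"
proof (rule pmorI)
  note Ob = pmorD(1,2)[OF R] pmorD(1,2)[OF S]
  show "prod_ob D X X' \<in> Ob D" "prod_ob D Y Y' \<in> Ob D"
    using Ob by simp_all
  fix p q assume pq: "(p, q) \<in> boxR X Y X' Y' R S"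
  then show "p \<in> car (prod_ob D X X') \<and> q \<in> car (prod_ob D Y Y') \<and>
      (act (prod_ob D X X') p, act (prod_ob D Y Y') q) \<in> boxR X Y X' Y' R S"
    using Ob pmorD(5)[OF R] pmorD(5)[OF S] by (simp add: boxR_def)
  fix q' assume "(p, q') \<in> boxR X Y X' Y' R S"
  with pq show "q = q'"
    using pmorD(6)[OF R] pmorD(6)[OF S] by - (rule pr_eqI[OF Ob(2,4)], auto simp: boxR_def)
qed

lemma prod_ar_props:
  assumes f: "f \<in> hom D U X" and g: "g \<in> hom D V Y"
  shows "prod_ar D f g \<in> hom D (prod_ob D U V) (prod_ob D X Y)"
    "p \<in> car (prod_ob D U V) \<Longrightarrow> pr0 X Y (fn (prod_ar D f g) p) = fn f (pr0 U V p)"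
    "p \<in> car (prod_ob D U V) \<Longrightarrow> pr1 X Y (fn (prod_ar D f g) p) = fn g (pr1 U V p)"
proof -
  note Ob = homD(1,2)[OF f] homD(1,2)[OF g]
  note P = proj_hom[OF Ob(2,4)] and Q = proj_hom[OF Ob(1,3)]
  let ?h = "prod_ar D f g"
  have "\<exists>!h. h \<in> hom D (prod_ob D U V) (prod_ob D X Y) \<and>
      prod_p0 D X Y \<cdot>\<^bsub>D\<^esub> h = f \<cdot>\<^bsub>D\<^esub> prod_p0 D U V \<and> prod_p1 D X Y \<cdot>\<^bsub>D\<^esub> h = g \<cdot>\<^bsub>D\<^esub> prod_p1 D U V"
    using homD(6)[OF Comp_hom[OF Q(1) f]] homD(6)[OF Comp_hom[OF Q(2) g]]
    by (intro tabulates_universal[OF prod_tabulates[OF Ob(2,4)] Comp_hom[OF Q(1) f] Comp_hom[OF Q(2) g]]) simp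
  from theI'[OF this] have h: "?h \<in> hom D (prod_ob D U V) (prod_ob D X Y) \<and>
      prod_p0 D X Y \<cdot>\<^bsub>D\<^esub> ?h = f \<cdot>\<^bsub>D\<^esub> prod_p0 D U V \<and> prod_p1 D X Y \<cdot>\<^bsub>D\<^esub> ?h = g \<cdot>\<^bsub>D\<^esub> prod_p1 D U V"
    unfolding prod_ar_def Let_def Dom_D Cod_D homD(4,5)[OF f] homD(4,5)[OF g] .
  then show H: "?h \<in> hom D (prod_ob D U V) (prod_ob D X Y)"
    by blast
  show "pr0 X Y (fn ?h p) = fn f (pr0 U V p)" "pr1 X Y (fn ?h p) = fn g (pr1 U V p)"
    if "p \<in> car (prod_ob D U V)"
    using h that by (simp_all add: comp_eq_comp_iff[OF H P(1) Q(1) f] comp_eq_comp_iff[OF H P(2) Q(2) g]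
        pr0_def pr1_def)
qed

lemma prod_diag_props:
  assumes X: "X \<in> Ob D"
  shows "prod_diag D X \<in> hom D X (prod_ob D X X)"
    "x \<in> car X \<Longrightarrow> fn (prod_diag D X) x = mkp X X x x"
proof -
  note P = proj_hom[OF X X] and I = Idn_hom[OF X]
  let ?h = "prod_diag D X"
  have "\<exists>!h. h \<in> hom D X (prod_ob D X X) \<and> prod_p0 D X X \<cdot>\<^bsub>D\<^esub> h = Idn D X \<and> prod_p1 D X X \<cdot>\<^bsub>D\<^esub> h = Idn D X"
    using X by (intro tabulates_universal[OF prod_tabulates[OF X X] I I]) simp
  from theI'[OF this] have h: "?h \<in> hom D X (prod_ob D X X) \<and>
      prod_p0 D X X \<cdot>\<^bsub>D\<^esub> ?h = Idn D X \<and> prod_p1 D X X \<cdot>\<^bsub>D\<^esub> ?h = Idn D X"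
    unfolding prod_diag_def .
  then show H: "?h \<in> hom D X (prod_ob D X X)"
    by blast
  show "fn ?h x = mkp X X x x" if x: "x \<in> car X"
    using h x X homD(6)[OF H x]
    by - (rule pr_eqI[OF X X], simp_all add: comp_eq_iff[OF H P(1) I] comp_eq_iff[OF H P(2) I] flip: pr0_def pr1_def)
qed

text \<open>A point of the product of the two sources is a pair of points, so the products of the legs
  take as values exactly the pairs that are related in both coordinates.\<close>
lemma Box_P:
  assumes R: "pmor X Y R" and S: "pmor X' Y' S"
  shows "cls X Y R \<boxtimes>\<^bsub>\<P>\<^esub> cls X' Y' S = cls (prod_ob D X X') (prod_ob D Y Y') (boxR X Y X' Y' R S)"
proof -
  have *: "pclass D (prod_ar D m n) (prod_ar D \<phi> \<psi>) =
      cls (prod_ob D X X') (prod_ob D Y Y') (boxR X Y X' Y' R S)"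
    if m: "(m, \<phi>) \<in> cls X Y R" and n: "(n, \<psi>) \<in> cls X' Y' S" for m \<phi> n \<psi>
  proof -
    obtain U where TU: "tabulates X Y R U m \<phi>"
      using m unfolding cls_def by blast
    obtain V where TV: "tabulates X' Y' S V n \<psi>"
      using n unfolding cls_def by blast
    have m: "m \<in> hom D U X" and \<phi>: "\<phi> \<in> hom D U Y" and n: "n \<in> hom D V X'" and \<psi>: "\<psi> \<in> hom D V Y'"
      using TU TV by (auto simp: tabulates_def)
    have Ob: "X \<in> Ob D" "Y \<in> Ob D" "X' \<in> Ob D" "Y' \<in> Ob D" "U \<in> Ob D" "V \<in> Ob D"
      using homD(1,2)[OF m] homD(2)[OF \<phi>] homD(1,2)[OF n] homD(2)[OF \<psi>] by blast+
    note h = prod_ar_props[OF m n] and k = prod_ar_props[OF \<phi> \<psi>]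
    have "tabulates (prod_ob D X X') (prod_ob D Y Y') (boxR X Y X' Y' R S) (prod_ob D U V)
        (prod_ar D m n) (prod_ar D \<phi> \<psi>)"
    proof (rule tabulatesI[OF h(1) k(1)])
      fix w assume w: "w \<in> car (prod_ob D U V)"
      show "(fn (prod_ar D m n) w, fn (prod_ar D \<phi> \<psi>) w) \<in> boxR X Y X' Y' R S"
        using w Ob by (simp add: boxR_def h k homD(6)[OF h(1)] homD(6)[OF k(1)]
            tabulates_image[OF TU] tabulates_image[OF TV])
    next
      fix w w' assume w: "w \<in> car (prod_ob D U V)" and w': "w' \<in> car (prod_ob D U V)"
        and "fn (prod_ar D m n) w = fn (prod_ar D m n) w'" "fn (prod_ar D \<phi> \<psi>) w = fn (prod_ar D \<phi> \<psi>) w'"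
      then have "fn m (pr0 U V w) = fn m (pr0 U V w')" "fn \<phi> (pr0 U V w) = fn \<phi> (pr0 U V w')"
        "fn n (pr1 U V w) = fn n (pr1 U V w')" "fn \<psi> (pr1 U V w) = fn \<psi> (pr1 U V w')"
        using h(2,3)[OF w] h(2,3)[OF w'] k(2,3)[OF w] k(2,3)[OF w'] by simp_all
      then show "w = w'"
        using w w' Ob tabulates_inj[OF TU, of "pr0 U V w" "pr0 U V w'"]
          tabulates_inj[OF TV, of "pr1 U V w" "pr1 U V w'"]
        by - (rule pr_eqI[OF Ob(5,6)], simp_all)
    next
      fix p q assume pq: "(p, q) \<in> boxR X Y X' Y' R S"
      then have R': "(pr0 X X' p, pr0 Y Y' q) \<in> R" and S': "(pr1 X X' p, pr1 Y Y' q) \<in> S"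
        by (simp_all add: boxR_def)
      obtain u where u: "u \<in> car U" "fn m u = pr0 X X' p" "fn \<phi> u = pr0 Y Y' q"
        using tabulates_surj[OF TU R'] .
      obtain v where v: "v \<in> car V" "fn n v = pr1 X X' p" "fn \<psi> v = pr1 Y Y' q"
        using tabulates_surj[OF TV S'] .
      have w: "mkp U V u v \<in> car (prod_ob D U V)"
        using u v Ob by simp
      have "fn (prod_ar D m n) (mkp U V u v) = p"
        using pq u v w Ob h(2,3)[OF w] homD(6)[OF h(1) w]
        by - (rule pr_eqI[OF Ob(1,3)], simp_all add: boxR_def)
      moreover have "fn (prod_ar D \<phi> \<psi>) (mkp U V u v) = q"
        using pq u v w Ob k(2,3)[OF w] homD(6)[OF k(1) w]
        by - (rule pr_eqI[OF Ob(2,4)], simp_all add: boxR_def)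
      ultimately show "\<exists>w\<in>car (prod_ob D U V). fn (prod_ar D m n) w = p \<and> fn (prod_ar D \<phi> \<psi>) w = q"
        using w by blast
    qed
    then show ?thesis
      by (rule pclass_eq_cls[OF pmor_box[OF R S]])
  qed
  obtain m \<phi> U where m: "(m, \<phi>) \<in> cls X Y R" "tabulates X Y R U m \<phi>"
    using cls_nonempty[OF R] .
  obtain n \<psi> V where n: "(n, \<psi>) \<in> cls X' Y' S" "tabulates X' Y' S V n \<psi>"
    using cls_nonempty[OF S] .
  have "{pclass D (prod_ar D m n) (prod_ar D \<phi> \<psi>) | m \<phi> n \<psi>. (m, \<phi>) \<in> cls X Y R \<and> (n, \<psi>) \<in> cls X' Y' S}
      = {cls (prod_ob D X X') (prod_ob D Y Y') (boxR X Y X' Y' R S)}"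
    using m n * by blast
  then show ?thesis
    by (simp add: Pfn_def)
qed

section \<open>Total maps\<close>

definition graph :: "'u dyn \<Rightarrow> ('u \<Rightarrow> 'u) \<Rightarrow> ('u \<times> 'u) set" where
  "graph X f = {(x, f x) | x. x \<in> car X}"

text \<open>The images of the morphisms of \<open>D\<close> under the embedding \<open>\<phi> \<mapsto> {1, \<phi>}\<close>; see \<open>pclass_embed\<close>.
  Identities between composites and near products of these reduce to identities of functions.\<close>
definition tmor :: "'u dyn \<Rightarrow> 'u dyn \<Rightarrow> ('u \<Rightarrow> 'u) \<Rightarrow> ('u dynar \<times> 'u dynar) set" where
  "tmor X Y f = cls X Y (graph X f)"

lemma mem_graph: "(x, y) \<in> graph X f \<longleftrightarrow> x \<in> car X \<and> y = f x"
  by (auto simp: graph_def)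

lemma tmor_cong: "(\<And>x. x \<in> car X \<Longrightarrow> f x = g x) \<Longrightarrow> tmor X Y f = tmor X Y g"
  unfolding tmor_def graph_def by (rule arg_cong[of _ _ "cls X Y"]) auto

lemma equivariantD:
  assumes "equivariant X Y f" "x \<in> car X"
  shows "f x \<in> car Y" "f (act X x) = act Y (f x)"
  using assms by (auto simp: equivariant_def)

lemma pmor_graph: "\<lbrakk>X \<in> Ob D; Y \<in> Ob D; equivariant X Y f\<rbrakk> \<Longrightarrow> pmor X Y (graph X f)"
  by (rule pmorI) (auto simp: mem_graph equivariantD)

lemma tmor_hom: "\<lbrakk>X \<in> Ob D; Y \<in> Ob D; equivariant X Y f\<rbrakk> \<Longrightarrow> tmor X Y f \<in> hom \<P> X Y"
  unfolding hom_P tmor_def by (blast intro: pmor_graph)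

lemma equivariant_id: "equivariant X X (\<lambda>x. x)"
  by (simp add: equivariant_def)

lemma equivariant_comp:
  "\<lbrakk>equivariant X Y f; equivariant Y Z g\<rbrakk> \<Longrightarrow> equivariant X Z (\<lambda>x. g (f x))"
  by (auto simp: equivariant_def)

lemma equivariant_pr:
  assumes "X \<in> Ob D" "Y \<in> Ob D"
  shows "equivariant (prod_ob D X Y) X (pr0 X Y)" "equivariant (prod_ob D X Y) Y (pr1 X Y)"
  using assms by (auto simp: equivariant_def)

lemma equivariant_mkp:
  assumes "X \<in> Ob D" "Y \<in> Ob D" "equivariant W X f" "equivariant W Y g"
  shows "equivariant W (prod_ob D X Y) (\<lambda>w. mkp X Y (f w) (g w))"
  using assms by (auto simp: equivariant_def Pi_iff)

lemma Idn_tmor: "X \<in> Ob D \<Longrightarrow> Idn \<P> X = tmor X X (\<lambda>x. x)"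
  unfolding Idn_P tmor_def by (rule arg_cong[of _ _ "cls X X"]) (auto simp: graph_def)

lemma Comp_tmor:
  assumes "X \<in> Ob D" "Y \<in> Ob D" "Z \<in> Ob D" "equivariant X Y f" "equivariant Y Z g"
  shows "tmor Y Z g \<cdot>\<^bsub>\<P>\<^esub> tmor X Y f = tmor X Z (\<lambda>x. g (f x))"
proof -
  have "graph X f O graph Y g = graph X (\<lambda>x. g (f x))"
    using assms(4) by (auto simp: graph_def equivariantD)
  then show ?thesis
    using assms by (simp add: tmor_def Comp_P pmor_graph)
qed

lemma Box_tmor:
  assumes Ob: "X \<in> Ob D" "Y \<in> Ob D" "X' \<in> Ob D" "Y' \<in> Ob D"
    and f: "equivariant X Y f" and g: "equivariant X' Y' g"
  shows "tmor X Y f \<boxtimes>\<^bsub>\<P>\<^esub> tmor X' Y' g =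
    tmor (prod_ob D X X') (prod_ob D Y Y') (\<lambda>p. mkp Y Y' (f (pr0 X X' p)) (g (pr1 X X' p)))"
proof -
  have "boxR X Y X' Y' (graph X f) (graph X' g) =
      graph (prod_ob D X X') (\<lambda>p. mkp Y Y' (f (pr0 X X' p)) (g (pr1 X X' p)))"
    using Ob equivariantD(1)[OF f] equivariantD(1)[OF g]
    by (auto simp: boxR_def mem_graph) (metis mkp_pr)
  then show ?thesis
    using assms by (simp add: tmor_def Box_P pmor_graph)
qed

lemma boxO_P [simp]: "boxO \<P> = prod_ob D"
  by (simp add: Pfn_def)

lemma pclass_embed:
  assumes f: "f \<in> hom D X Y"
  shows "pclass D (Idn D X) f = tmor X Y (fn f)"
proof -
  note X = homD(1)[OF f]
  have "equivariant X Y (fn f)"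
    using homD(6)[OF f] homD(7)[OF f] by (simp add: equivariant_def)
  then have P: "pmor X Y (graph X (fn f))"
    by (rule pmor_graph[OF homD(1,2)[OF f]])
  have "tabulates X Y (graph X (fn f)) X (Idn D X) f"
    using X by (auto intro!: tabulatesI[OF Idn_hom[OF X] f] simp: mem_graph)
  then show ?thesis
    unfolding tmor_def by (rule pclass_eq_cls[OF P])
qed

lemma proj0_tmor:
  "\<lbrakk>X \<in> Ob D; Y \<in> Ob D\<rbrakk> \<Longrightarrow> proj0 \<P> X Y = tmor (prod_ob D X Y) X (pr0 X Y)"
  by (simp add: Pfn_def pr0_def pclass_embed[OF proj_hom(1)])

lemma proj1_tmor:
  "\<lbrakk>X \<in> Ob D; Y \<in> Ob D\<rbrakk> \<Longrightarrow> proj1 \<P> X Y = tmor (prod_ob D X Y) Y (pr1 X Y)"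
  by (simp add: Pfn_def pr1_def pclass_embed[OF proj_hom(2)])

lemma diag_tmor:
  assumes "X \<in> Ob D"
  shows "diag \<P> X = tmor X (prod_ob D X X) (\<lambda>x. mkp X X x x)"
proof -
  have "diag \<P> X = tmor X (prod_ob D X X) (fn (prod_diag D X))"
    by (simp add: Pfn_def pclass_embed[OF prod_diag_props(1)[OF assms]])
  also have "\<dots> = tmor X (prod_ob D X X) (\<lambda>x. mkp X X x x)"
    by (rule tmor_cong) (rule prod_diag_props(2)[OF assms])
  finally show ?thesis .
qed

lemma Dom_tmor: "\<lbrakk>X \<in> Ob D; Y \<in> Ob D; equivariant X Y f\<rbrakk> \<Longrightarrow> Dom \<P> (tmor X Y f) = X"
  by (simp add: tmor_def pmor_graph)

lemma Pair_tmor: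
  assumes Ob: "W \<in> Ob D" "X \<in> Ob D" "Y \<in> Ob D"
    and f: "equivariant W X f" and g: "equivariant W Y g"
  shows "pair_ar \<P> (tmor W X f) (tmor W Y g) = tmor W (prod_ob D X Y) (\<lambda>w. mkp X Y (f w) (g w))"
proof -
  have "pair_ar \<P> (tmor W X f) (tmor W Y g) =
      tmor (prod_ob D W W) (prod_ob D X Y) (\<lambda>p. mkp X Y (f (pr0 W W p)) (g (pr1 W W p))) \<cdot>\<^bsub>\<P>\<^esub>
      tmor W (prod_ob D W W) (\<lambda>x. mkp W W x x)"
    using assms by (simp add: pair_ar_def Dom_tmor Box_tmor diag_tmor)
  also have "\<dots> = tmor W (prod_ob D X Y)
      (\<lambda>x. mkp X Y (f (pr0 W W (mkp W W x x))) (g (pr1 W W (mkp W W x x))))"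
    using Ob by (intro Comp_tmor equivariant_mkp equivariant_id prod_Ob
        equivariant_comp[OF _ f] equivariant_comp[OF _ g] equivariant_pr)
  also have "\<dots> = tmor W (prod_ob D X Y) (\<lambda>w. mkp X Y (f w) (g w))"
    using Ob by (intro tmor_cong) simp
  finally show ?thesis .
qed

abbreviation assoc_fun :: "'u dyn \<Rightarrow> 'u dyn \<Rightarrow> 'u dyn \<Rightarrow> 'u \<Rightarrow> 'u" where
  "assoc_fun X Y Z \<equiv> (\<lambda>p. mkp X (prod_ob D Y Z) (pr0 X Y (pr0 (prod_ob D X Y) Z p))
     (mkp Y Z (pr1 X Y (pr0 (prod_ob D X Y) Z p)) (pr1 (prod_ob D X Y) Z p)))"

abbreviation symm_fun :: "'u dyn \<Rightarrow> 'u dyn \<Rightarrow> 'u \<Rightarrow> 'u" where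
  "symm_fun X Y \<equiv> (\<lambda>p. mkp Y X (pr1 X Y p) (pr0 X Y p))"

lemma equivariant_assoc:
  "\<lbrakk>X \<in> Ob D; Y \<in> Ob D; Z \<in> Ob D\<rbrakk> \<Longrightarrow>
    equivariant (prod_ob D (prod_ob D X Y) Z) (prod_ob D X (prod_ob D Y Z)) (assoc_fun X Y Z)"
  by (intro equivariant_mkp prod_Ob equivariant_pr equivariant_comp[OF _ equivariant_pr(1)]
      equivariant_comp[OF _ equivariant_pr(2)])

lemma equivariant_symm:
  "\<lbrakk>X \<in> Ob D; Y \<in> Ob D\<rbrakk> \<Longrightarrow> equivariant (prod_ob D X Y) (prod_ob D Y X) (symm_fun X Y)"
  by (intro equivariant_mkp prod_Ob equivariant_pr)

lemma assoc_tmor: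
  assumes Ob: "X \<in> Ob D" "Y \<in> Ob D" "Z \<in> Ob D"
  shows "assoc_ar \<P> X Y Z =
    tmor (prod_ob D (prod_ob D X Y) Z) (prod_ob D X (prod_ob D Y Z)) (assoc_fun X Y Z)"
  using Ob by (simp add: assoc_ar_def proj0_tmor proj1_tmor Comp_tmor Pair_tmor equivariant_pr
      equivariant_mkp equivariant_comp[OF equivariant_pr(1) equivariant_pr(1)]
      equivariant_comp[OF equivariant_pr(1) equivariant_pr(2)])

lemma symm_tmor:
  "\<lbrakk>X \<in> Ob D; Y \<in> Ob D\<rbrakk> \<Longrightarrow>
    symm_ar \<P> X Y = tmor (prod_ob D X Y) (prod_ob D Y X) (symm_fun X Y)"
  by (simp add: symm_ar_def proj0_tmor proj1_tmor Pair_tmor equivariant_pr)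

section \<open>The P-category of partial maps\<close>

lemma Ar_cases:
  assumes "c \<in> Ar \<P>"
  obtains X Y R where "pmor X Y R" "c = cls X Y R"
  using assms unfolding Ar_P by blast

lemma hom_cases:
  assumes "c \<in> hom \<P> X Y"
  obtains R where "pmor X Y R" "c = cls X Y R"
  using assms unfolding hom_P by blast

lemma cls_Ar: "pmor X Y R \<Longrightarrow> cls X Y R \<in> Ar \<P>"
  unfolding Ar_P by blast

lemma cls_hom: "pmor X Y R \<Longrightarrow> cls X Y R \<in> hom \<P> X Y"
  unfolding hom_P by blast

lemma category_P: "category \<P>"
proof
  fix c assume "c \<in> Ar \<P>"
  then show "Dom \<P> c \<in> Ob \<P>" "Cod \<P> c \<in> Ob \<P>"
    by (auto elim!: Ar_cases intro: pmorD(1,2))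
next
  fix X assume "X \<in> Ob \<P>"
  then show "Idn \<P> X \<in> hom \<P> X X"
    by (simp add: Idn_P cls_hom pmor_Id)
next
  fix f g X Y Z assume "f \<in> hom \<P> X Y" "g \<in> hom \<P> Y Z"
  then show "g \<cdot>\<^bsub>\<P>\<^esub> f \<in> hom \<P> X Z"
    by (elim hom_cases) (simp add: Comp_P cls_hom pmor_comp)
next
  fix f X Y assume "f \<in> hom \<P> X Y"
  then obtain R where R: "pmor X Y R" "f = cls X Y R"
    by (rule hom_cases)
  then have "Id_on (car X) O R = R" "R O Id_on (car Y) = R"
    using pmorD(3,4)[OF R(1)] by auto
  with R show "f \<cdot>\<^bsub>\<P>\<^esub> Idn \<P> X = f" "Idn \<P> Y \<cdot>\<^bsub>\<P>\<^esub> f = f"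
    by (simp_all add: Idn_P pmorD(1,2)[OF R(1)] Comp_P[OF pmor_Id R(1)] Comp_P[OF R(1) pmor_Id])
next
  fix f g h W X Y Z assume "f \<in> hom \<P> W X" "g \<in> hom \<P> X Y" "h \<in> hom \<P> Y Z"
  then obtain R S T where "pmor W X R" "f = cls W X R" "pmor X Y S" "g = cls X Y S"
    "pmor Y Z T" "h = cls Y Z T"
    by (elim hom_cases) blast
  then show "(h \<cdot>\<^bsub>\<P>\<^esub> g) \<cdot>\<^bsub>\<P>\<^esub> f = h \<cdot>\<^bsub>\<P>\<^esub> (g \<cdot>\<^bsub>\<P>\<^esub> f)"
    by (simp add: Comp_P pmor_comp O_assoc)
qed

lemma boxR_comp:
  assumes R: "pmor X Y R" "pmor Y Z R'" and S: "pmor U V S" "pmor V W S'"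
  shows "boxR X Z U W (R O R') (S O S') = boxR X Y U V R S O boxR Y Z V W R' S'"
proof
  show "boxR X Z U W (R O R') (S O S') \<subseteq> boxR X Y U V R S O boxR Y Z V W R' S'"
  proof safe
    fix p r assume pr: "(p, r) \<in> boxR X Z U W (R O R') (S O S')"
    then obtain y v where "(pr0 X U p, y) \<in> R" "(y, pr0 Z W r) \<in> R'"
      "(pr1 X U p, v) \<in> S" "(v, pr1 Z W r) \<in> S'"
      by (auto simp: boxR_def)
    then have "(p, mkp Y V y v) \<in> boxR X Y U V R S" "(mkp Y V y v, r) \<in> boxR Y Z V W R' S'"
      using pr pmorD(2,4)[OF R(1)] pmorD(2,4)[OF S(1)] by (simp_all add: boxR_def)
    then show "(p, r) \<in> boxR X Y U V R S O boxR Y Z V W R' S'"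
      by blast
  qed
qed (auto simp: boxR_def)

lemma box_functor_P: "is_functor (\<P> \<times>\<^sub>C \<P>) \<P> (box_func \<P>)"
  unfolding is_functor_def
proof (intro conjI ballI impI)
  fix XY assume "XY \<in> Ob (\<P> \<times>\<^sub>C \<P>)"
  then obtain X Y where XY: "XY = (X, Y)" "X \<in> Ob D" "Y \<in> Ob D"
    by auto
  then show "FOb (box_func \<P>) XY \<in> Ob \<P>"
    by (simp add: box_func_def)
  have "tmor (prod_ob D X Y) (prod_ob D X Y) (\<lambda>p. mkp X Y (pr0 X Y p) (pr1 X Y p)) =
      tmor (prod_ob D X Y) (prod_ob D X Y) (\<lambda>p. p)"
    using XY by (intro tmor_cong) simp
  then show "FAr (box_func \<P>) (Idn (\<P> \<times>\<^sub>C \<P>) XY) = Idn \<P> (FOb (box_func \<P>) XY)"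
    using XY by (simp add: box_func_def Idn_tmor Box_tmor equivariant_id)
next
  fix f assume "f \<in> Ar (\<P> \<times>\<^sub>C \<P>)"
  then obtain X Y R U V S where f: "f = (cls X Y R, cls U V S)" and R: "pmor X Y R" and S: "pmor U V S"
    by (auto elim!: Ar_cases)
  then show "FAr (box_func \<P>) f \<in> hom \<P> (FOb (box_func \<P>) (Dom (\<P> \<times>\<^sub>C \<P>) f))
      (FOb (box_func \<P>) (Cod (\<P> \<times>\<^sub>C \<P>) f))"
    by (simp add: box_func_def Box_P cls_hom pmor_box)
next
  fix f g assume "f \<in> Ar (\<P> \<times>\<^sub>C \<P>)" "g \<in> Ar (\<P> \<times>\<^sub>C \<P>)" and gf: "Dom (\<P> \<times>\<^sub>C \<P>) g = Cod (\<P> \<times>\<^sub>C \<P>) f"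
  then obtain X Y R U V S Y' Z R' V' W S' where f: "f = (cls X Y R, cls U V S)" 
    and R: "pmor X Y R" and S: "pmor U V S"
    and g: "g = (cls Y' Z R', cls V' W S')" and R': "pmor Y' Z R'" and S': "pmor V' W S'"
    by (auto elim!: Ar_cases)
  have "Y' = Y" "V' = V"
    using gf R S R' S' by (simp_all add: f g)
  then show "FAr (box_func \<P>) (g \<cdot>\<^bsub>\<P> \<times>\<^sub>C \<P>\<^esub> f) = FAr (box_func \<P>) g \<cdot>\<^bsub>\<P>\<^esub> FAr (box_func \<P>) f"
    using f g R S R' S'
    by (simp add: box_func_def Box_P Comp_P[of X Y R Z R'] Comp_P[of U V S W S'] pmor_comp
        Comp_P[OF pmor_box[OF R S] pmor_box] boxR_comp)
qed

lemma equivariant_pr_comp: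
  assumes "X \<in> Ob D" "Y \<in> Ob D" "equivariant W (prod_ob D X Y) f"
  shows "equivariant W X (\<lambda>w. pr0 X Y (f w))" "equivariant W Y (\<lambda>w. pr1 X Y (f w))"
  using equivariant_comp[OF assms(3) equivariant_pr(1)] equivariant_comp[OF assms(3) equivariant_pr(2)]
    assms(1,2) by blast+

lemmas equivariant_rules = equivariant_id equivariant_pr equivariant_mkp equivariant_pr_comp

text \<open>For partial maps, naturality of the diagonal amounts to single-valuedness: two values at the
  same argument form a diagonal pair.\<close>
lemma diag_natural_P:
  "natural \<P> \<P> id_func \<lparr>FOb = (\<lambda>X. X \<box>\<^bsub>\<P>\<^esub> X), FAr = (\<lambda>f. f \<boxtimes>\<^bsub>\<P>\<^esub> f)\<rparr> (diag \<P>)"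
proof -
  have "diag \<P> (Cod \<P> f) \<cdot>\<^bsub>\<P>\<^esub> f = (f \<boxtimes>\<^bsub>\<P>\<^esub> f) \<cdot>\<^bsub>\<P>\<^esub> diag \<P> (Dom \<P> f)" if "f \<in> Ar \<P>" for f
  proof -
    obtain X Y R where R: "pmor X Y R" and f: "f = cls X Y R"
      using \<open>f \<in> Ar \<P>\<close> by (rule Ar_cases)
    note Ob = pmorD(1,2)[OF R]
    let ?dX = "\<lambda>x. mkp X X x x" and ?dY = "\<lambda>y. mkp Y Y y y"
    have X: "pmor X (prod_ob D X X) (graph X ?dX)" and Y: "pmor Y (prod_ob D Y Y) (graph Y ?dY)"
      using Ob by (simp_all add: pmor_graph equivariant_rules)
    have "R O graph Y ?dY = graph X ?dX O boxR X Y X Y R R"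
    proof (rule subset_antisym; rule subrelI)
      fix x p assume "(x, p) \<in> R O graph Y ?dY"
      then have "(x, ?dX x) \<in> graph X ?dX \<and> (?dX x, p) \<in> boxR X Y X Y R R"
        using Ob pmorD(3,4)[OF R] by (auto simp: mem_graph boxR_def)
      then show "(x, p) \<in> graph X ?dX O boxR X Y X Y R R"
        by blast
    next
      fix x p assume "(x, p) \<in> graph X ?dX O boxR X Y X Y R R"
      then have p: "p \<in> car (prod_ob D Y Y)" "(x, pr0 Y Y p) \<in> R" "(x, pr1 Y Y p) \<in> R"
        using Ob by (auto simp: mem_graph boxR_def)
      have "p = ?dY (pr0 Y Y p)"
        using p Ob pmorD(6)[OF R p(2,3)] mkp_pr[OF Ob(2,2) p(1)] by simp
      then have "(pr0 Y Y p, p) \<in> graph Y ?dY"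
        using p Ob by (simp add: mem_graph)
      with p show "(x, p) \<in> R O graph Y ?dY"
        by blast
    qed
    then show ?thesis
      using R Ob by (simp add: f diag_tmor tmor_def Comp_P[OF R Y] Comp_P[OF X pmor_box[OF R R]] Box_P)
  qed
  moreover have "diag \<P> X \<in> hom \<P> X (prod_ob D X X)" if "X \<in> Ob D" for X
    using that by (simp add: diag_tmor tmor_hom equivariant_rules)
  ultimately show ?thesis
    by (simp add: natural_def infranatural_def natural_on_def)
qed

lemma proj0_infranatural_P:
  "infranatural (\<P> \<times>\<^sub>C \<P>) \<P> (box_func \<P>) \<lparr>FOb = fst, FAr = fst\<rparr> (case_prod (proj0 \<P>))"
  using tmor_hom[OF prod_Ob] by (auto simp: infranatural_def box_func_def proj0_tmor equivariant_rules)

lemma proj1_infranatural_P: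
  "infranatural (\<P> \<times>\<^sub>C \<P>) \<P> (box_func \<P>) \<lparr>FOb = snd, FAr = snd\<rparr> (case_prod (proj1 \<P>))"
  using tmor_hom[OF prod_Ob] by (auto simp: infranatural_def box_func_def proj1_tmor equivariant_rules)

lemma proj_diag_P:
  assumes X: "X \<in> Ob D"
  shows "proj0 \<P> X X \<cdot>\<^bsub>\<P>\<^esub> diag \<P> X = Idn \<P> X" "proj1 \<P> X X \<cdot>\<^bsub>\<P>\<^esub> diag \<P> X = Idn \<P> X"
  using X by (auto simp: proj0_tmor proj1_tmor diag_tmor Idn_tmor Comp_tmor equivariant_rules
      intro!: tmor_cong)

lemma proj_box_diag_P:
  assumes "X \<in> Ob D" "Y \<in> Ob D"
  shows "(proj0 \<P> X Y \<boxtimes>\<^bsub>\<P>\<^esub> proj1 \<P> X Y) \<cdot>\<^bsub>\<P>\<^esub> diag \<P> (prod_ob D X Y) = Idn \<P> (prod_ob D X Y)"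
  using assms by (simp add: proj0_tmor proj1_tmor diag_tmor Idn_tmor Comp_tmor Box_tmor equivariant_rules)
    (rule tmor_cong, simp)

definition total_maps :: "('u dynar \<times> 'u dynar) set set" where
  "total_maps = {tmor X Y f | X Y f. X \<in> Ob D \<and> Y \<in> Ob D \<and> equivariant X Y f}"

lemma tmor_ends:
  assumes "X \<in> Ob D" "Y \<in> Ob D" "equivariant X Y f"
  shows "Dom \<P> (tmor X Y f) = X" "Cod \<P> (tmor X Y f) = Y" "tmor X Y f \<in> Ar \<P>"
  using assms by (simp_all add: tmor_def pmor_graph cls_Ar)

lemma total_mapsI: "\<lbrakk>X \<in> Ob D; Y \<in> Ob D; equivariant X Y f\<rbrakk> \<Longrightarrow> tmor X Y f \<in> total_maps"
  unfolding total_maps_def by blast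

lemma total_mapsE:
  assumes "t \<in> total_maps"
  obtains X Y f where "t = tmor X Y f" "X \<in> Ob D" "Y \<in> Ob D" "equivariant X Y f"
  using assms unfolding total_maps_def by blast

lemma total_maps_subcategory: "wide_subcategory \<P> total_maps"
  unfolding wide_subcategory_def subcategory_def
proof (intro conjI ballI impI)
  show "total_maps \<subseteq> Ar \<P>"
    by (auto elim!: total_mapsE simp: tmor_ends)
next
  fix f assume "f \<in> total_maps"
  then show "Idn \<P> (Dom \<P> f) \<in> total_maps" "Idn \<P> (Cod \<P> f) \<in> total_maps"
    by (auto elim!: total_mapsE simp: tmor_ends Idn_tmor intro!: total_mapsI equivariant_id)
next
  fix f g assume "f \<in> total_maps" "g \<in> total_maps" "Dom \<P> g = Cod \<P> f"
  then obtain X Y Z a b where "f = tmor X Y a" "g = tmor Y Z b" "X \<in> Ob D" "Y \<in> Ob D" "Z \<in> Ob D"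
    "equivariant X Y a" "equivariant Y Z b"
    by (auto elim!: total_mapsE simp: tmor_ends)
  then show "g \<cdot>\<^bsub>\<P>\<^esub> f \<in> total_maps"
    by (simp add: Comp_tmor total_mapsI equivariant_comp)
next
  fix X assume "X \<in> Ob \<P>"
  then show "Idn \<P> X \<in> total_maps"
    by (simp add: Idn_tmor total_mapsI equivariant_id)
qed

lemma equivariant_box:
  assumes "X \<in> Ob D" "Y \<in> Ob D" "X' \<in> Ob D" "Y' \<in> Ob D" "equivariant X Y f" "equivariant X' Y' g"
  shows "equivariant (prod_ob D X X') (prod_ob D Y Y') (\<lambda>p. mkp Y Y' (f (pr0 X X' p)) (g (pr1 X X' p)))"
  using assms by (intro equivariant_mkp equivariant_comp[OF _ assms(5)] equivariant_comp[OF _ assms(6)]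
      equivariant_pr)

text \<open>The total maps form a subcategory closed under \<open>\<boxtimes>\<close> that contains the projections. Unlike
  membership in \<open>proj_subcat\<close>, totality is explicit, and it suffices for the naturality of the
  projections.\<close>
lemma proj_subcat_total: "proj_subcat \<P> \<subseteq> total_maps"
proof -
  have "f \<boxtimes>\<^bsub>\<P>\<^esub> g \<in> total_maps" if "f \<in> total_maps" "g \<in> total_maps" for f g
    using that by (auto elim!: total_mapsE simp: Box_tmor intro!: total_mapsI equivariant_box)
  moreover have "proj0 \<P> X Y \<in> total_maps" "proj1 \<P> X Y \<in> total_maps" if "X \<in> Ob D" "Y \<in> Ob D" for X Y
    using that by (auto simp: proj0_tmor proj1_tmor intro!: total_mapsI equivariant_pr)
  ultimately show ?thesis
    using total_maps_subcategory unfolding proj_subcat_def wide_subcategory_def Ob_P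
    by (intro Inter_lower CollectI conjI ballI) blast+
qed

text \<open>Naturality of a projection in the factor that it discards requires a total map there: a
  partial map \<open>f\<close> would cut down the domain of the left-hand side to the points whose discarded
  coordinate lies in the domain of \<open>f\<close>.\<close>
lemma proj0_rel:
  assumes R: "pmor X Y R" and Ob: "U \<in> Ob D" "V \<in> Ob D" and f: "equivariant U V f"
  shows "boxR X Y U V R (graph U f) O graph (prod_ob D Y V) (pr0 Y V) =
    graph (prod_ob D X U) (pr0 X U) O R"
proof (rule subset_antisym; rule subrelI)
  fix p y assume "(p, y) \<in> boxR X Y U V R (graph U f) O graph (prod_ob D Y V) (pr0 Y V)"
  then have "(p, pr0 X U p) \<in> graph (prod_ob D X U) (pr0 X U) \<and> (pr0 X U p, y) \<in> R"
    by (auto simp: boxR_def mem_graph)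
  then show "(p, y) \<in> graph (prod_ob D X U) (pr0 X U) O R"
    by blast
next
  fix p y assume "(p, y) \<in> graph (prod_ob D X U) (pr0 X U) O R"
  then have p: "p \<in> car (prod_ob D X U)" "(pr0 X U p, y) \<in> R"
    by (auto simp: mem_graph)
  let ?q = "mkp Y V y (f (pr1 X U p))"
  have "(p, ?q) \<in> boxR X Y U V R (graph U f)" "(?q, y) \<in> graph (prod_ob D Y V) (pr0 Y V)"
    using p Ob pmorD(1,2)[OF R] pmorD(4)[OF R p(2)] equivariantD(1)[OF f]
    by (simp_all add: boxR_def mem_graph)
  then show "(p, y) \<in> boxR X Y U V R (graph U f) O graph (prod_ob D Y V) (pr0 Y V)"
    by blast
qed

lemma proj1_rel:
  assumes R: "pmor X Y R" and Ob: "U \<in> Ob D" "V \<in> Ob D" and f: "equivariant U V f"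
  shows "boxR U V X Y (graph U f) R O graph (prod_ob D V Y) (pr1 V Y) =
    graph (prod_ob D U X) (pr1 U X) O R"
proof (rule subset_antisym; rule subrelI)
  fix p y assume "(p, y) \<in> boxR U V X Y (graph U f) R O graph (prod_ob D V Y) (pr1 V Y)"
  then have "(p, pr1 U X p) \<in> graph (prod_ob D U X) (pr1 U X) \<and> (pr1 U X p, y) \<in> R"
    by (auto simp: boxR_def mem_graph)
  then show "(p, y) \<in> graph (prod_ob D U X) (pr1 U X) O R"
    by blast
next
  fix p y assume "(p, y) \<in> graph (prod_ob D U X) (pr1 U X) O R"
  then have p: "p \<in> car (prod_ob D U X)" "(pr1 U X p, y) \<in> R"
    by (auto simp: mem_graph)
  let ?q = "mkp V Y (f (pr0 U X p)) y"
  have "(p, ?q) \<in> boxR U V X Y (graph U f) R" "(?q, y) \<in> graph (prod_ob D V Y) (pr1 V Y)"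
    using p Ob pmorD(1,2)[OF R] pmorD(4)[OF R p(2)] equivariantD(1)[OF f]
    by (simp_all add: boxR_def mem_graph)
  then show "(p, y) \<in> boxR U V X Y (graph U f) R O graph (prod_ob D V Y) (pr1 V Y)"
    by blast
qed

lemma proj0_nat_P:
  "Ar \<P> \<times> proj_subcat \<P> \<subseteq>
    nat_part (\<P> \<times>\<^sub>C \<P>) \<P> (box_func \<P>) \<lparr>FOb = fst, FAr = fst\<rparr> (case_prod (proj0 \<P>))"
proof -
  have "proj0 \<P> (Cod \<P> c) (Cod \<P> t) \<cdot>\<^bsub>\<P>\<^esub> (c \<boxtimes>\<^bsub>\<P>\<^esub> t) = c \<cdot>\<^bsub>\<P>\<^esub> proj0 \<P> (Dom \<P> c) (Dom \<P> t)"
    if c: "c \<in> Ar \<P>" and t: "t \<in> total_maps" for c t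
  proof -
    obtain X Y R where R: "pmor X Y R" "c = cls X Y R"
      using c by (rule Ar_cases)
    obtain U V f where f: "t = tmor U V f" "U \<in> Ob D" "V \<in> Ob D" "equivariant U V f"
      using t by (rule total_mapsE)
    note Ob = pmorD(1,2)[OF R(1)] f(2,3)
    note F = pmor_graph[OF f(2-4)]
    have X: "pmor (prod_ob D X U) X (graph (prod_ob D X U) (pr0 X U))"
      and Y: "pmor (prod_ob D Y V) Y (graph (prod_ob D Y V) (pr0 Y V))"
      using Ob by (simp_all add: pmor_graph equivariant_pr)
    show ?thesis
      using R(1) F Ob by (simp add: R(2) f(1) proj0_tmor tmor_def Box_P Comp_P[OF pmor_box[OF R(1) F] Y]
          Comp_P[OF X R(1)] proj0_rel[OF R(1) f(2-4)])
  qed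
  then have "natural_on (\<P> \<times>\<^sub>C \<P>) \<P> (box_func \<P>) \<lparr>FOb = fst, FAr = fst\<rparr> (case_prod (proj0 \<P>))
      (Ar \<P> \<times> total_maps)"
    by (auto simp: natural_on_def box_func_def)
  moreover have "wide_subcategory (\<P> \<times>\<^sub>C \<P>) (Ar \<P> \<times> total_maps)"
    by (intro wide_prod category.wide_Ar category_P total_maps_subcategory)
  ultimately have "Ar \<P> \<times> total_maps \<subseteq>
      nat_part (\<P> \<times>\<^sub>C \<P>) \<P> (box_func \<P>) \<lparr>FOb = fst, FAr = fst\<rparr> (case_prod (proj0 \<P>))"
    unfolding nat_part_def by blast
  then show ?thesis
    using proj_subcat_total by blast
qed

lemma proj1_nat_P:
  "proj_subcat \<P> \<times> Ar \<P> \<subseteq>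
    nat_part (\<P> \<times>\<^sub>C \<P>) \<P> (box_func \<P>) \<lparr>FOb = snd, FAr = snd\<rparr> (case_prod (proj1 \<P>))"
proof -
  have "proj1 \<P> (Cod \<P> t) (Cod \<P> c) \<cdot>\<^bsub>\<P>\<^esub> (t \<boxtimes>\<^bsub>\<P>\<^esub> c) = c \<cdot>\<^bsub>\<P>\<^esub> proj1 \<P> (Dom \<P> t) (Dom \<P> c)"
    if c: "c \<in> Ar \<P>" and t: "t \<in> total_maps" for c t
  proof -
    obtain X Y R where R: "pmor X Y R" "c = cls X Y R"
      using c by (rule Ar_cases)
    obtain U V f where f: "t = tmor U V f" "U \<in> Ob D" "V \<in> Ob D" "equivariant U V f"
      using t by (rule total_mapsE)
    note Ob = pmorD(1,2)[OF R(1)] f(2,3)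
    note F = pmor_graph[OF f(2-4)]
    have X: "pmor (prod_ob D U X) X (graph (prod_ob D U X) (pr1 U X))"
      and Y: "pmor (prod_ob D V Y) Y (graph (prod_ob D V Y) (pr1 V Y))"
      using Ob by (simp_all add: pmor_graph equivariant_pr)
    show ?thesis
      using R(1) F Ob by (simp add: R(2) f(1) proj1_tmor tmor_def Box_P Comp_P[OF pmor_box[OF F R(1)] Y]
          Comp_P[OF X R(1)] proj1_rel[OF R(1) f(2-4)])
  qed
  then have "natural_on (\<P> \<times>\<^sub>C \<P>) \<P> (box_func \<P>) \<lparr>FOb = snd, FAr = snd\<rparr> (case_prod (proj1 \<P>))
      (total_maps \<times> Ar \<P>)"
    by (auto simp: natural_on_def box_func_def)
  moreover have "wide_subcategory (\<P> \<times>\<^sub>C \<P>) (total_maps \<times> Ar \<P>)"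
    by (intro wide_prod category.wide_Ar category_P total_maps_subcategory)
  ultimately have "total_maps \<times> Ar \<P> \<subseteq>
      nat_part (\<P> \<times>\<^sub>C \<P>) \<P> (box_func \<P>) \<lparr>FOb = snd, FAr = snd\<rparr> (case_prod (proj1 \<P>))"
    unfolding nat_part_def by blast
  then show ?thesis
    using proj_subcat_total by blast
qed

lemma iso_tmor:
  assumes Ob: "X \<in> Ob D" "Y \<in> Ob D" and f: "equivariant X Y f" and g: "equivariant Y X g"
    and gf: "\<And>x. x \<in> car X \<Longrightarrow> g (f x) = x" and fg: "\<And>y. y \<in> car Y \<Longrightarrow> f (g y) = y"
  shows "iso_ar \<P> (tmor X Y f)"
proof -
  have "tmor Y X g \<cdot>\<^bsub>\<P>\<^esub> tmor X Y f = Idn \<P> X" "tmor X Y f \<cdot>\<^bsub>\<P>\<^esub> tmor Y X g = Idn \<P> Y"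
    using Ob f g gf fg by (auto simp: Comp_tmor Idn_tmor intro!: tmor_cong)
  then show ?thesis
    using Ob f g tmor_hom[OF Ob(2,1) g] by (auto simp: iso_ar_def tmor_ends)
qed

lemma assoc_rel:
  assumes R: "pmor X X' R" and S: "pmor Y Y' S" and T: "pmor Z Z' T"
  shows "boxR (prod_ob D X Y) (prod_ob D X' Y') Z Z' (boxR X X' Y Y' R S) T O
      graph (prod_ob D (prod_ob D X' Y') Z') (assoc_fun X' Y' Z') =
    graph (prod_ob D (prod_ob D X Y) Z) (assoc_fun X Y Z) O
      boxR X X' (prod_ob D Y Z) (prod_ob D Y' Z') R (boxR Y Y' Z Z' S T)" (is "?L = ?R")
proof (rule subset_antisym; rule subrelI)
  note Ob [simp] = pmorD(1,2)[OF R] pmorD(1,2)[OF S] pmorD(1,2)[OF T]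
  fix p q assume "(p, q) \<in> ?L"
  then have "(p, assoc_fun X Y Z p) \<in> graph (prod_ob D (prod_ob D X Y) Z) (assoc_fun X Y Z) \<and>
      (assoc_fun X Y Z p, q) \<in> boxR X X' (prod_ob D Y Z) (prod_ob D Y' Z') R (boxR Y Y' Z Z' S T)"
    by (auto simp: boxR_def mem_graph)
  then show "(p, q) \<in> ?R"
    by blast
next
  note Ob [simp] = pmorD(1,2)[OF R] pmorD(1,2)[OF S] pmorD(1,2)[OF T]
  fix p q assume pq: "(p, q) \<in> ?R"
  let ?q = "mkp (prod_ob D X' Y') Z' (mkp X' Y' (pr0 X' (prod_ob D Y' Z') q)
      (pr0 Y' Z' (pr1 X' (prod_ob D Y' Z') q))) (pr1 Y' Z' (pr1 X' (prod_ob D Y' Z') q))"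
  have "(p, ?q) \<in> boxR (prod_ob D X Y) (prod_ob D X' Y') Z Z' (boxR X X' Y Y' R S) T \<and>
      (?q, q) \<in> graph (prod_ob D (prod_ob D X' Y') Z') (assoc_fun X' Y' Z')"
    using pq by (auto simp: boxR_def mem_graph)
  then show "(p, q) \<in> ?L"
    by blast
qed

lemma symm_rel:
  assumes R: "pmor X X' R" and S: "pmor Y Y' S"
  shows "boxR X X' Y Y' R S O graph (prod_ob D X' Y') (symm_fun X' Y') =
    graph (prod_ob D X Y) (symm_fun X Y) O boxR Y Y' X X' S R" (is "?L = ?R")
proof (rule subset_antisym; rule subrelI)
  note Ob [simp] = pmorD(1,2)[OF R] pmorD(1,2)[OF S]
  fix p q assume "(p, q) \<in> ?L"
  then have "(p, symm_fun X Y p) \<in> graph (prod_ob D X Y) (symm_fun X Y) \<and>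
      (symm_fun X Y p, q) \<in> boxR Y Y' X X' S R"
    by (auto simp: boxR_def mem_graph)
  then show "(p, q) \<in> ?R"
    by blast
next
  note Ob [simp] = pmorD(1,2)[OF R] pmorD(1,2)[OF S]
  fix p q assume "(p, q) \<in> ?R"
  then have "(p, symm_fun Y' X' q) \<in> boxR X X' Y Y' R S \<and>
      (symm_fun Y' X' q, q) \<in> graph (prod_ob D X' Y') (symm_fun X' Y')"
    by (auto simp: boxR_def mem_graph)
  then show "(p, q) \<in> ?L"
    by blast
qed

lemma assoc_natural_iso_P:
  "natural_iso (\<P> \<times>\<^sub>C \<P> \<times>\<^sub>C \<P>) \<P>
     \<lparr>FOb = (\<lambda>(X, Y, Z). (X \<box>\<^bsub>\<P>\<^esub> Y) \<box>\<^bsub>\<P>\<^esub> Z), FAr = (\<lambda>(f, g, h). (f \<boxtimes>\<^bsub>\<P>\<^esub> g) \<boxtimes>\<^bsub>\<P>\<^esub> h)\<rparr>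
     \<lparr>FOb = (\<lambda>(X, Y, Z). X \<box>\<^bsub>\<P>\<^esub> (Y \<box>\<^bsub>\<P>\<^esub> Z)), FAr = (\<lambda>(f, g, h). f \<boxtimes>\<^bsub>\<P>\<^esub> (g \<boxtimes>\<^bsub>\<P>\<^esub> h))\<rparr>
     (\<lambda>(X, Y, Z). assoc_ar \<P> X Y Z)"
proof -
  have hom: "assoc_ar \<P> X Y Z \<in> hom \<P> (prod_ob D (prod_ob D X Y) Z) (prod_ob D X (prod_ob D Y Z))"
    and iso: "iso_ar \<P> (assoc_ar \<P> X Y Z)"
    if Ob: "X \<in> Ob D" "Y \<in> Ob D" "Z \<in> Ob D" for X Y Z
  proof -
    show "assoc_ar \<P> X Y Z \<in> hom \<P> (prod_ob D (prod_ob D X Y) Z) (prod_ob D X (prod_ob D Y Z))"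
      using Ob by (simp add: assoc_tmor tmor_hom equivariant_assoc)
    show "iso_ar \<P> (assoc_ar \<P> X Y Z)"
      unfolding assoc_tmor[OF Ob]
    proof (rule iso_tmor)
      show "equivariant (prod_ob D X (prod_ob D Y Z)) (prod_ob D (prod_ob D X Y) Z)
          (\<lambda>q. mkp (prod_ob D X Y) Z (mkp X Y (pr0 X (prod_ob D Y Z) q)
            (pr0 Y Z (pr1 X (prod_ob D Y Z) q))) (pr1 Y Z (pr1 X (prod_ob D Y Z) q)))"
        using Ob by (simp add: equivariant_rules)
    qed (use Ob in \<open>simp_all add: equivariant_rules\<close>)
  qed
  have nat: "assoc_ar \<P> (Cod \<P> f) (Cod \<P> g) (Cod \<P> h) \<cdot>\<^bsub>\<P>\<^esub> ((f \<boxtimes>\<^bsub>\<P>\<^esub> g) \<boxtimes>\<^bsub>\<P>\<^esub> h) =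
      (f \<boxtimes>\<^bsub>\<P>\<^esub> (g \<boxtimes>\<^bsub>\<P>\<^esub> h)) \<cdot>\<^bsub>\<P>\<^esub> assoc_ar \<P> (Dom \<P> f) (Dom \<P> g) (Dom \<P> h)"
    if f: "f \<in> Ar \<P>" and g: "g \<in> Ar \<P>" and h: "h \<in> Ar \<P>" for f g h
  proof -
    obtain X X' R where R: "pmor X X' R" "f = cls X X' R"
      using f by (rule Ar_cases)
    obtain Y Y' S where S: "pmor Y Y' S" "g = cls Y Y' S"
      using g by (rule Ar_cases)
    obtain Z Z' T where T: "pmor Z Z' T" "h = cls Z Z' T"
      using h by (rule Ar_cases)
    note Ob = pmorD(1,2)[OF R(1)] pmorD(1,2)[OF S(1)] pmorD(1,2)[OF T(1)]
    note A = pmor_graph[OF _ _ equivariant_assoc[OF Ob(1,3,5)]]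
      and A' = pmor_graph[OF _ _ equivariant_assoc[OF Ob(2,4,6)]]
    show ?thesis
      unfolding R(2) S(2) T(2) Dom_P[OF R(1)] Dom_P[OF S(1)] Dom_P[OF T(1)]
        Cod_P[OF R(1)] Cod_P[OF S(1)] Cod_P[OF T(1)]
        assoc_tmor[OF Ob(1,3,5)] assoc_tmor[OF Ob(2,4,6)] tmor_def
        Box_P[OF R(1) S(1)] Box_P[OF S(1) T(1)] Box_P[OF pmor_box[OF R(1) S(1)] T(1)]
        Box_P[OF R(1) pmor_box[OF S(1) T(1)]]
      using Ob by (simp add: Comp_P[OF pmor_box[OF pmor_box[OF R(1) S(1)] T(1)] A']
        Comp_P[OF A pmor_box[OF R(1) pmor_box[OF S(1) T(1)]]] assoc_rel[OF R(1) S(1) T(1)])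
  qed
  show ?thesis
    using hom iso nat by (auto simp: natural_iso_def natural_def infranatural_def natural_on_def)
qed

lemma symm_natural_iso_P:
  "natural_iso (\<P> \<times>\<^sub>C \<P>) \<P> (box_func \<P>)
     \<lparr>FOb = (\<lambda>(X, Y). Y \<box>\<^bsub>\<P>\<^esub> X), FAr = (\<lambda>(f, g). g \<boxtimes>\<^bsub>\<P>\<^esub> f)\<rparr> (\<lambda>(X, Y). symm_ar \<P> X Y)"
proof -
  have hom: "symm_ar \<P> X Y \<in> hom \<P> (prod_ob D X Y) (prod_ob D Y X)" and iso: "iso_ar \<P> (symm_ar \<P> X Y)"
    if Ob: "X \<in> Ob D" "Y \<in> Ob D" for X Y
  proof -
    show "symm_ar \<P> X Y \<in> hom \<P> (prod_ob D X Y) (prod_ob D Y X)"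
      using Ob by (simp add: symm_tmor tmor_hom equivariant_symm)
    show "iso_ar \<P> (symm_ar \<P> X Y)"
      unfolding symm_tmor[OF Ob]
      by (rule iso_tmor[where g = "symm_fun Y X"]) (use Ob in \<open>simp_all add: equivariant_rules\<close>)
  qed
  have nat: "symm_ar \<P> (Cod \<P> f) (Cod \<P> g) \<cdot>\<^bsub>\<P>\<^esub> (f \<boxtimes>\<^bsub>\<P>\<^esub> g) =
      (g \<boxtimes>\<^bsub>\<P>\<^esub> f) \<cdot>\<^bsub>\<P>\<^esub> symm_ar \<P> (Dom \<P> f) (Dom \<P> g)"
    if f: "f \<in> Ar \<P>" and g: "g \<in> Ar \<P>" for f g
  proof -
    obtain X X' R where R: "pmor X X' R" "f = cls X X' R"
      using f by (rule Ar_cases)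
    obtain Y Y' S where S: "pmor Y Y' S" "g = cls Y Y' S"
      using g by (rule Ar_cases)
    note Ob = pmorD(1,2)[OF R(1)] pmorD(1,2)[OF S(1)]
    note A = pmor_graph[OF _ _ equivariant_symm[OF Ob(1,3)]]
      and A' = pmor_graph[OF _ _ equivariant_symm[OF Ob(2,4)]]
    show ?thesis
      unfolding R(2) S(2) Dom_P[OF R(1)] Dom_P[OF S(1)] Cod_P[OF R(1)] Cod_P[OF S(1)]
        symm_tmor[OF Ob(1,3)] symm_tmor[OF Ob(2,4)] tmor_def Box_P[OF R(1) S(1)] Box_P[OF S(1) R(1)]
      using Ob by (simp add: Comp_P[OF pmor_box[OF R(1) S(1)] A']
        Comp_P[OF A pmor_box[OF S(1) R(1)]] symm_rel[OF R(1) S(1)])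
  qed
  show ?thesis
    using hom iso nat by (auto simp: natural_iso_def natural_def infranatural_def natural_on_def box_func_def)
qed

lemma p_category_P: "p_category \<P>"
proof -
  interpret category \<P>
    by (rule category_P)
  show ?thesis
  proof unfold_locales
    fix W X Y Z assume "W \<in> Ob \<P>" "X \<in> Ob \<P>" "Y \<in> Ob \<P>" "Z \<in> Ob \<P>"
    then show "assoc_ar \<P> W X (Y \<box>\<^bsub>\<P>\<^esub> Z) \<cdot>\<^bsub>\<P>\<^esub> assoc_ar \<P> (W \<box>\<^bsub>\<P>\<^esub> X) Y Z =
      (Idn \<P> W \<boxtimes>\<^bsub>\<P>\<^esub> assoc_ar \<P> X Y Z) \<cdot>\<^bsub>\<P>\<^esub> assoc_ar \<P> W (X \<box>\<^bsub>\<P>\<^esub> Y) Z \<cdot>\<^bsub>\<P>\<^esub>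
        (assoc_ar \<P> W X Y \<boxtimes>\<^bsub>\<P>\<^esub> Idn \<P> Z)"
      by (simp add: assoc_tmor Idn_tmor Box_tmor Comp_tmor equivariant_rules) (rule tmor_cong, simp)
  next
    fix X Y Z assume "X \<in> Ob \<P>" "Y \<in> Ob \<P>" "Z \<in> Ob \<P>"
    then show "assoc_ar \<P> Y Z X \<cdot>\<^bsub>\<P>\<^esub> symm_ar \<P> X (Y \<box>\<^bsub>\<P>\<^esub> Z) \<cdot>\<^bsub>\<P>\<^esub> assoc_ar \<P> X Y Z =
      (Idn \<P> Y \<boxtimes>\<^bsub>\<P>\<^esub> symm_ar \<P> X Z) \<cdot>\<^bsub>\<P>\<^esub> assoc_ar \<P> Y X Z \<cdot>\<^bsub>\<P>\<^esub> (symm_ar \<P> X Y \<boxtimes>\<^bsub>\<P>\<^esub> Idn \<P> Z)"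
      by (simp add: assoc_tmor symm_tmor Idn_tmor Box_tmor Comp_tmor equivariant_rules)
        (rule tmor_cong, simp)
  next
    fix X Y assume "X \<in> Ob \<P>" "Y \<in> Ob \<P>"
    then show "symm_ar \<P> Y X \<cdot>\<^bsub>\<P>\<^esub> symm_ar \<P> X Y = Idn \<P> (X \<box>\<^bsub>\<P>\<^esub> Y)"
      by (simp add: symm_tmor Idn_tmor Comp_tmor equivariant_rules) (rule tmor_cong, simp)
  qed (simp_all add: box_functor_P diag_natural_P[simplified] proj0_infranatural_P proj1_infranatural_P
      proj_diag_P proj_box_diag_P proj0_nat_P proj1_nat_P assoc_natural_iso_P[simplified]
      symm_natural_iso_P[simplified])
qed


section \<open>Zero morphisms and weak totality\<close>

definition zero :: "'u dyn \<Rightarrow> 'u dyn \<Rightarrow> ('u dynar \<times> 'u dynar) set" where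
  "zero X Y = cls X Y {}"

lemma pmor_empty: "\<lbrakk>X \<in> Ob D; Y \<in> Ob D\<rbrakk> \<Longrightarrow> pmor X Y {}"
  by (rule pmorI) auto

lemma zero_system_P: "zero_system \<P> zero"
  unfolding zero_system_def
proof (intro conjI ballI)
  fix X Y assume "X \<in> Ob \<P>" "Y \<in> Ob \<P>"
  then show "zero X Y \<in> hom \<P> X Y"
    by (simp add: zero_def cls_hom pmor_empty)
next
  fix f g assume f: "f \<in> Ar \<P>" and g: "g \<in> Ar \<P>"
  obtain W X R where R: "pmor W X R" "f = cls W X R"
    using f by (rule Ar_cases)
  obtain Y Z S where S: "pmor Y Z S" "g = cls Y Z S"
    using g by (rule Ar_cases)
  note Ob = pmorD(1,2)[OF R(1)] pmorD(1,2)[OF S(1)]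
  have "cls X Y {} \<cdot>\<^bsub>\<P>\<^esub> cls W X R = cls W Y {}"
    using Comp_P[OF R(1) pmor_empty[OF Ob(2,3)]] by simp
  then show "g \<cdot>\<^bsub>\<P>\<^esub> zero (Cod \<P> f) (Dom \<P> g) \<cdot>\<^bsub>\<P>\<^esub> f = zero (Dom \<P> f) (Cod \<P> g)"
    using R S Comp_P[OF pmor_empty[OF Ob(1,3)] S(1)] by (simp add: zero_def)
qed

lemma prodominical_P: "prodominical \<P>"
  unfolding prodominical_def
proof (intro conjI exI ballI)
  show "p_category \<P>"
    by (rule p_category_P)
  show "zero_system \<P> zero"
    by (rule zero_system_P)
  fix f X Y assume f: "f \<in> Ar \<P>" and Ob: "X \<in> Ob \<P>" "Y \<in> Ob \<P>"
  obtain U V R where R: "pmor U V R" "f = cls U V R"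
    using f by (rule Ar_cases)
  have "boxR U V X Y R {} = {}"
    by (simp add: boxR_def)
  then show "f \<boxtimes>\<^bsub>\<P>\<^esub> zero X Y = zero (Dom \<P> f \<box>\<^bsub>\<P>\<^esub> X) (Cod \<P> f \<box>\<^bsub>\<P>\<^esub> Y)"
    using R Ob by (simp add: zero_def Box_P pmor_empty)
qed

lemma dom_cls:
  assumes R: "pmor X Y R"
  shows "dom_ar \<P> (cls X Y R) = cls X X (Id_on (Domain R))"
proof -
  note Ob = pmorD(1,2)[OF R] and I = pmor_Id[OF pmorD(1)[OF R]]
  have X: "pmor X (prod_ob D X X) (graph X (\<lambda>x. mkp X X x x))"
    and P: "pmor (prod_ob D X Y) X (graph (prod_ob D X Y) (pr0 X Y))"
    using Ob by (simp_all add: pmor_graph equivariant_rules)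
  have "(graph X (\<lambda>x. mkp X X x x) O boxR X X X Y (Id_on (car X)) R) O graph (prod_ob D X Y) (pr0 X Y) =
      Id_on (Domain R)" (is "?L = _")
  proof (rule subset_antisym; rule subrelI)
    fix x z assume "(x, z) \<in> ?L"
    then show "(x, z) \<in> Id_on (Domain R)"
      using Ob by (auto simp: mem_graph boxR_def)
  next
    fix x x' assume "(x, x') \<in> Id_on (Domain R)"
    then obtain y where xy: "(x, y) \<in> R" and x': "x' = x"
      by blast
    then have "(x, mkp X X x x) \<in> graph X (\<lambda>x. mkp X X x x)"
      "(mkp X X x x, mkp X Y x y) \<in> boxR X X X Y (Id_on (car X)) R"
      "(mkp X Y x y, x) \<in> graph (prod_ob D X Y) (pr0 X Y)"
      using Ob pmorD(3,4)[OF R xy] by (simp_all add: mem_graph boxR_def Id_on_iff)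
    then show "(x, x') \<in> ?L"
      unfolding x' by blast
  qed
  then show ?thesis
    using R Ob by (simp add: dom_ar_def pair_ar_def Idn_P diag_tmor proj0_tmor tmor_def pmor_Id
        Box_P[OF I R] Comp_P[OF X pmor_box[OF I R]] Comp_P[OF pmor_comp[OF X pmor_box[OF I R]] P])
qed

lemma not_dominical_P: "\<not> dominical \<P>"
proof
  assume "dominical \<P>"
  then have wt: "\<And>f. \<lbrakk>f \<in> Ar \<P>; weakly_total \<P> zero f\<rbrakk> \<Longrightarrow> total_ar \<P> f"
    using zero_system_P unfolding dominical_def by blast
  obtain A where A: "A \<in> \<U>" "card A = 2"
    using two_element_set by blast
  then obtain a b where ab: "A = {a, b}" "a \<noteq> b"
    by (auto simp: card_2_iff)
  define X where "X = dyn_of A (\<lambda>_. b)"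
  have X: "X \<in> Ob D" "car X = {a, b}" "act X a = b" "act X b = b"
    using A ab by (auto simp: X_def)
  have R: "pmor X X {(b, b)}"
    using X by (intro pmorI) auto
  have "weakly_total \<P> zero (cls X X {(b, b)})"
    unfolding weakly_total_def
  proof (intro ballI impI)
    fix c assume c: "c \<in> Ar \<P>" and cod: "Cod \<P> c = Dom \<P> (cls X X {(b, b)})"
      and z: "cls X X {(b, b)} \<cdot>\<^bsub>\<P>\<^esub> c = zero (Dom \<P> c) (Cod \<P> (cls X X {(b, b)}))"
    obtain W S where S: "pmor W X S" "c = cls W X S"
      using Ar_cases[OF c] cod R by (metis Cod_P Dom_P)
    have "cls W X (S O {(b, b)}) = cls W X {}"
      using z S R by (simp add: Comp_P zero_def)
    then have "S O {(b, b)} = {}"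
      by (simp add: cls_eq_iff[OF pmor_comp[OF S(1) R]])
    \<comment> \<open>invariance moves any value of \<open>S\<close> to \<open>b\<close>, where the partial identity is defined\<close>
    moreover have "(act W w, b) \<in> S" if "(w, x) \<in> S" for w x
      using pmorD(4,5)[OF S(1) that] X by auto
    ultimately have "S = {}"
      by fast
    then show "c = zero (Dom \<P> c) (Dom \<P> (cls X X {(b, b)}))"
      using S R by (simp add: zero_def)
  qed
  then have "total_ar \<P> (cls X X {(b, b)})"
    by (rule wt[OF cls_Ar[OF R]])
  then have "cls X X (Id_on (car X)) = cls X X (Id_on {b})"
    using R X by (simp add: total_ar_def dom_cls Idn_P)
  then have "Id_on (car X) = Id_on {b}"
    by (simp add: cls_eq_iff[OF pmor_Id[OF X(1)]])
  then show False
    using X ab by auto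
qed

end

theorem proposition1p6:
  fixes \<U> :: "'u set set"
  assumes "set_universe \<U>"
  shows "prodominical (Pfn (Coalg (SET \<U>) id_func)) \<and>
         \<not> dominical (Pfn (Coalg (SET \<U>) id_func))"
proof -
  interpret set_universe \<U>
    by (rule assms)
  show ?thesis
    using prodominical_P not_dominical_P by blast
qed

end
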